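(* Let $n\ge 2$ and let $m_1,\dots,m_{n-1}$ be integers such that either $m_1,\dots,m_{n-1}\in\mathbb{N}$ (all exponents positive) or $-m_1,\dots,-m_{n-1}\in\mathbb{N}$ (all exponents negative). Let $L$ be the closure of the braid word $\sigma_1^{m_1}\sigma_2^{m_2}\cdots\sigma_{n-1}^{m_{n-1}}\in B_n$. Then $L$ (with its closed-braid diagram) admits a dimer model.
   Context: Here $\mathbb{N}=\{1,2,3,\dots\}$. **Braids.** $B_n$ is the $n$-strand braid group with standard generators $\sigma_1,\dots,\sigma_{n-1}$; $\sigma_i$ is a single crossing between the strands in positions $i$ and $i+1$, which is a positive crossing when all strands are oriented in the same direction (so the closure of $\sigma_1^3\in B_2$ is the right-handed trefoil), and $\sigma_i^{-1}$ is the opposite crossing. Braid words are read from left to right and stacked from top to bottom. The closure connects each top endpoint to the bottom endpoint in the same position by arcs running on the right of the braid; the closed-braid diagram is the resulting planar diagram. **Bracket polynomial.** The $A$-smoothing of a crossing is the smoothing that joins the two regions swept out when the over-strand is rotated counterclockwise; the $B$-smoothing is the other one. For a positive crossing the $A$-smoothing is the orientation-respecting one. The bracket polynomial $\langle\cdot\rangle\in\mathbb{Z}[A,A^{-1}]$ of link diagrams is determined by $\langle O\rangle=1$ for the crossingless unknot diagram $O$, $\langle D\rangle=A\langle D_A\rangle+A^{-1}\langle D_B\rangle$ for the $A$- and $B$-smoothings $D_A,D_B$ of $D$ at a crossing, and $\langle O\sqcup D\rangle=(-A^2-A^{-2})\langle D\rangle$. **Checkerboard signs.** Checkerboard-color the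 faces of a diagram so that the outside face is not shaded. A crossing is called positive (with respect to the coloring) if its $A$-smoothing joins the two shaded corners at the crossing, and negative otherwise. **Balanced overlaid Tait graph.** Let $V_1$ be the set of crossings, $V_2$ the set of shaded faces and $V_3$ the set of unshaded faces (including the outside face). Omit one $v_2\in V_2$ and one $v_3\in V_3$ whose corresponding faces touch along a common strand of the diagram, and let $W=(V_2\cup V_3)\setminus\{v_2,v_3\}$. The balanced overlaid Tait graph is the bipartite graph on $V_1\sqcup W$ in which $v\in V_1$ is adjacent to $w\in W$ iff the crossing $v$ touches the face $w$. One has $|V_1|=|W|$. **Activity letters.** Fix a total order on $V_1$. For $w\in W$ a shaded face, the edge joining $w$ to its lowest adjacent vertex gets weight $L$ and all other edges at $w$ get weight $D$. For $w$ an unshaded face, the edge joining $w$ to its lowest adjacent vertex gets weight $\ell$ and all other edges at $w$ get weight $d$. If the crossing endpoint of an edge is negative (with respect to the coloring), the letter is replaced by its barred version $\overline{L},\overline{D},\overline{\ell},\overline{d}$. The specialization $\mu(e)$ of an edge $e$ is $-A^{-3}$ if its letter is $L$ or $\overline{\ell}$; $-A^{3}$ if it is $\ell$ or $\overline{L}$; $A$ if it is $D$ or $\overline{d}$; $A^{-1}$ if it is $d$ or $\overline{D}$. **Dimer model.** A perfect matching of a graph is a set of edges such that every vertex is incident to exactly one of them. A link diagram $L$ admits a dimer model if, for some choice of the omitted faces and some ordering of $V_1$, the partition function $Z(L)=\sum_P\prod_{e\in P}\mu(e)$, summed over all perfect matchings $P$ of its balanced overlaid Tait graph, equals $\langle L\rangle$.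 *)

theory Defs
  imports "HOL-Library.Poly_Mapping"
begin

section \<open>Laurent polynomials\<close>

text \<open>The group ring of the integers over the integers, that is, \<open>\<int>[A, A\<inverse>]\<close>:
  \<open>single k c\<close> stands for \<open>c A\<^sup>k\<close>, and multiplication is convolution.\<close>

type_synonym laurent = "int \<Rightarrow>\<^sub>0 int"

definition A_pow :: "int \<Rightarrow> laurent" where
  "A_pow k = Poly_Mapping.single k 1"


section \<open>Planar diagrams\<close>

text \<open>The ends of a crossing are labelled counterclockwise, starting with an end of the
  under-strand; so ends 0 and 2 belong to the under-strand, and 1 and 3 to the over-strand.\<close>

datatype 'a crossing = Crossing 'a 'a 'a 'a

primrec end_label :: "'a crossing \<Rightarrow> nat \<Rightarrow> 'a" where
  "end_label (Crossing a b c d) i = [a, b, c, d] ! i"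

text \<open>A planar diagram consists of crossings and of crossingless strands (\<open>joins\<close>), given by
  the labels of their ends. Every label occurs exactly twice, and the two pieces of the diagram
  carrying it are glued there. In particular \<open>(a, a)\<close> is a crossingless circle.\<close>

datatype 'a pd = PD (crossings: "'a crossing list") (joins: "('a \<times> 'a) list")

definition connected_by :: "('a \<times> 'a) list \<Rightarrow> 'a rel" where
  "connected_by S = (set S \<union> (set S)\<inverse>)\<^sup>*"

definition circles :: "('a \<times> 'a) list \<Rightarrow> nat" where
  "circles S = card (Field (set S) // connected_by S)"


section \<open>The bracket polynomial\<close>

text \<open>Rotating the over-strand (ends 1 and 3) counterclockwise sweeps out the region between
  ends 1 and 2 and the one between ends 3 and 0. Hence the A-smoothing connects end 0 with end 1
  and end 2 with end 3. A crossingless diagram with \<open>k \<ge> 1\<close> circles has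
  bracket \<open>(-A\<^sup>2 - A\<^sup>-\<^sup>2)\<^sup>k\<^sup>-\<^sup>1\<close>. The lemmas below confirm the defining rules of the
  bracket; in particular the skein relation holds at every crossing, not just at the first.\<close>

function bracket :: "'a pd \<Rightarrow> laurent" where
  "bracket (PD [] S) = (- A_pow 2 - A_pow (-2)) ^ (circles S - 1)"
| "bracket (PD (Crossing a b c d # Xs) S) =
     A_pow 1 * bracket (PD Xs ((a, b) # (c, d) # S)) +
     A_pow (-1) * bracket (PD Xs ((b, c) # (d, a) # S))"
  by pat_completeness auto
termination by (relation "measure (length \<circ> crossings)") auto

lemma bracket_cong: "set S = set S' \<Longrightarrow> bracket (PD Xs S) = bracket (PD Xs S')"
proof (induction Xs arbitrary: S S')
  case Nil
  then show ?case by (simp add: circles_def connected_by_def)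
next
  case (Cons x Xs)
  obtain a b c d where x: "x = Crossing a b c d" by (cases x)
  have "bracket (PD Xs ((a, b) # (c, d) # S)) = bracket (PD Xs ((a, b) # (c, d) # S'))"
    "bracket (PD Xs ((b, c) # (d, a) # S)) = bracket (PD Xs ((b, c) # (d, a) # S'))"
    by (rule Cons.IH, simp add: Cons.prems)+
  then show ?case by (simp add: x)
qed

lemma bracket_unknot: "bracket (PD [] [(a, a)]) = 1"
  by (simp add: circles_def quotient_def)

lemma bracket_skein:
  "bracket (PD (Xs @ Crossing a b c d # Ys) S) =
     A_pow 1 * bracket (PD (Xs @ Ys) ((a, b) # (c, d) # S)) +
     A_pow (-1) * bracket (PD (Xs @ Ys) ((b, c) # (d, a) # S))"
proof (induction Xs arbitrary: S)
  case Nil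
  then show ?case by simp
next
  case (Cons x Xs)
  obtain p q r s where x: "x = Crossing p q r s" by (cases x)
  have swap: "bracket (PD Zs (e # f # g # h # S)) = bracket (PD Zs (g # h # e # f # S))"
    for Zs and e f g h :: "'a \<times> 'a"
    by (rule bracket_cong) auto
  show ?case
    by (simp add: x Cons.IH swap[of _ "(a, b)"] swap[of _ "(b, c)"] algebra_simps)
qed

lemma circles_insert_circle:
  assumes "a \<notin> Field (set S)"
  shows "circles ((a, a) # S) = Suc (circles S)"
proof -
  have fin: "finite (Field (set S))" by (simp add: finite_Field)
  have sub: "connected_by S \<subseteq> Id \<union> Field (set S) \<times> Field (set S)"
  proof (rule subrelI)
    fix x y assume "(x, y) \<in> connected_by S"
    then show "(x, y) \<in> Id \<union> Field (set S) \<times> Field (set S)"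
      unfolding connected_by_def
      by (induction rule: rtrancl_induct) (auto simp: Field_def)
  qed
  have "set ((a, a) # S) \<union> (set ((a, a) # S))\<inverse> = set S \<union> (set S)\<inverse> \<union> {(a, a)}"
    by auto
  moreover have "(set S \<union> (set S)\<inverse> \<union> {(a, a)})\<^sup>* = (set S \<union> (set S)\<inverse>)\<^sup>*"
    by (rule rtrancl_subset) auto
  ultimately have eq: "connected_by ((a, a) # S) = connected_by S"
    by (simp only: connected_by_def)
  have "connected_by S `` {a} = {a}"
    using sub assms by (auto simp: connected_by_def)
  then have q: "Field (set ((a, a) # S)) // connected_by ((a, a) # S) =
      insert {a} (Field (set S) // connected_by S)"
    unfolding eq by (auto simp: quotient_def Field_def)
  have "{a} \<notin> Field (set S) // connected_by S"
  proof
    assume "{a} \<in> Field (set S) // connected_by S"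
    then obtain x where "x \<in> Field (set S)" "connected_by S `` {x} = {a}"
      by (auto simp: quotient_def)
    moreover have "x \<in> connected_by S `` {x}" by (simp add: connected_by_def)
    ultimately show False using assms by auto
  qed
  moreover have "finite (Field (set S) // connected_by S)"
    using fin by (simp add: quotient_def)
  ultimately show ?thesis
    unfolding circles_def q by simp
qed

lemma bracket_disjoint_circle:
  assumes "a \<notin> Field (set S)" and "\<forall>x\<in>set Xs. a \<notin> set_crossing x"
    and "Xs \<noteq> [] \<or> S \<noteq> []"
  shows "bracket (PD Xs ((a, a) # S)) = (- A_pow 2 - A_pow (-2)) * bracket (PD Xs S)"
  using assms
proof (induction Xs arbitrary: S)
  case Nil
  then obtain x where "x \<in> Field (set S)" by (cases S) (auto simp: Field_def)
  moreover have "finite (Field (set S) // connected_by S)"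
    by (simp add: quotient_def finite_Field)
  ultimately have "circles S > 0"
    by (auto simp: circles_def quotient_def card_gt_0_iff)
  then show ?case
    using circles_insert_circle[OF Nil.prems(1)] by (simp add: power_eq_if)
next
  case (Cons x Xs)
  obtain p q r s where x: "x = Crossing p q r s" by (cases x)
  have fresh: "a \<notin> {p, q, r, s}" using Cons.prems(2) by (simp add: x)
  have "bracket (PD Xs ((p, q) # (r, s) # (a, a) # S)) =
      bracket (PD Xs ((a, a) # (p, q) # (r, s) # S))"
    by (rule bracket_cong) auto
  also have "\<dots> = (- A_pow 2 - A_pow (-2)) * bracket (PD Xs ((p, q) # (r, s) # S))"
    by (rule Cons.IH) (use Cons.prems fresh in \<open>auto simp: Field_def\<close>)
  finally have 1: "bracket (PD Xs ((p, q) # (r, s) # (a, a) # S)) =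
      (- A_pow 2 - A_pow (-2)) * bracket (PD Xs ((p, q) # (r, s) # S))" .
  have "bracket (PD Xs ((q, r) # (s, p) # (a, a) # S)) =
      bracket (PD Xs ((a, a) # (q, r) # (s, p) # S))"
    by (rule bracket_cong) auto
  also have "\<dots> = (- A_pow 2 - A_pow (-2)) * bracket (PD Xs ((q, r) # (s, p) # S))"
    by (rule Cons.IH) (use Cons.prems fresh in \<open>auto simp: Field_def\<close>)
  finally have 2: "bracket (PD Xs ((q, r) # (s, p) # (a, a) # S)) =
      (- A_pow 2 - A_pow (-2)) * bracket (PD Xs ((q, r) # (s, p) # S))" .
  show ?case by (simp add: x 1 2 algebra_simps)
qed


section \<open>Faces and checkerboard colorings\<close>

text \<open>Crossings are referred to by their index in the list. The pair \<open>(k, i)\<close> with \<open>i < 4\<close>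
  denotes end \<open>i\<close> of crossing \<open>k\<close>, and also the corner of crossing \<open>k\<close> that lies between its
  ends \<open>i\<close> and \<open>i + 1\<close> (mod 4). So end \<open>(k, i)\<close> lies between the corners \<open>(k, i)\<close> and
  \<open>(k, i + 3)\<close> (mod 4).\<close>

definition corners :: "'a pd \<Rightarrow> (nat \<times> nat) set" where
  "corners D = {..<length (crossings D)} \<times> {..<4}"

definition same_strand :: "'a pd \<Rightarrow> nat \<times> nat \<Rightarrow> nat \<times> nat \<Rightarrow> bool" where
  "same_strand D e f \<longleftrightarrow> e \<in> corners D \<and> f \<in> corners D \<and> e \<noteq> f \<and>
     (end_label (crossings D ! fst e) (snd e), end_label (crossings D ! fst f) (snd f))
       \<in> connected_by (joins D)"

text \<open>Leaving crossing \<open>k\<close> through end \<open>i + 1\<close>, one has corner \<open>(k, i)\<close> on the right. If the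
  strand arrives at end \<open>j\<close> of crossing \<open>k'\<close>, then corner \<open>(k', j)\<close> is on the right.\<close>

definition next_corner :: "'a pd \<Rightarrow> (nat \<times> nat) rel" where
  "next_corner D = {((k, i), (k', j)). (k, i) \<in> corners D \<and> (k', j) \<in> corners D \<and>
     same_strand D (k, (i + 1) mod 4) (k', j)}"

text \<open>Faces are represented by their sets of corners. This is the usual notion of face for
  connected diagrams with at least one crossing.\<close>

definition face_of :: "'a pd \<Rightarrow> nat \<times> nat \<Rightarrow> (nat \<times> nat) set" where
  "face_of D c = (next_corner D \<union> (next_corner D)\<inverse>)\<^sup>* `` {c}"

definition faces :: "'a pd \<Rightarrow> (nat \<times> nat) set set" where
  "faces D = face_of D ` corners D"

definition touches :: "'a pd \<Rightarrow> nat \<Rightarrow> (nat \<times> nat) set \<Rightarrow> bool" where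
  "touches D v w \<longleftrightarrow> (\<exists>i<4. face_of D (v, i) = w)"

definition touch_along_strand ::
    "'a pd \<Rightarrow> (nat \<times> nat) set \<Rightarrow> (nat \<times> nat) set \<Rightarrow> bool" where
  "touch_along_strand D w w' \<longleftrightarrow>
     (\<exists>(k, i)\<in>corners D. {w, w'} = {face_of D (k, i), face_of D (k, (i + 3) mod 4)})"

text \<open>A coloring is given by its set \<open>S\<close> of shaded faces; \<open>out\<close> is a corner of the outside
  face.\<close>

definition checkerboard :: "'a pd \<Rightarrow> nat \<times> nat \<Rightarrow> (nat \<times> nat) set set \<Rightarrow> bool" where
  "checkerboard D out S \<longleftrightarrow> S \<subseteq> faces D \<and> face_of D out \<notin> S \<and>
     (\<forall>(k, i)\<in>corners D. face_of D (k, i) \<in> S \<longleftrightarrow> face_of D (k, (i + 3) mod 4) \<notin> S)"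

text \<open>The A-smoothing joins corners 1 and 3.\<close>

definition positive_crossing :: "'a pd \<Rightarrow> (nat \<times> nat) set set \<Rightarrow> nat \<Rightarrow> bool" where
  "positive_crossing D S v \<longleftrightarrow> face_of D (v, 1) \<in> S \<and> face_of D (v, 3) \<in> S"


section \<open>Activity letters and the dimer model\<close>

type_synonym edge = "nat \<times> (nat \<times> nat) set"

definition tait_edges :: "'a pd \<Rightarrow> (nat \<times> nat) set set \<Rightarrow> edge set" where
  "tait_edges D W = {(v, w). v < length (crossings D) \<and> w \<in> W \<and> touches D v w}"

definition perfect_matching :: "'v set \<Rightarrow> 'w set \<Rightarrow> ('v \<times> 'w) set \<Rightarrow> ('v \<times> 'w) set \<Rightarrow> bool" where
  "perfect_matching V W E P \<longleftrightarrow> P \<subseteq> E \<and>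
     (\<forall>v\<in>V. \<exists>!e. e \<in> P \<and> fst e = v) \<and> (\<forall>w\<in>W. \<exists>!e. e \<in> P \<and> snd e = w)"

datatype letter = Letter_L | Letter_D | Letter_l | Letter_d

definition lowest :: "'a pd \<Rightarrow> nat rel \<Rightarrow> edge \<Rightarrow> bool" where
  "lowest D r = (\<lambda>(v, w). touches D v w \<and>
     (\<forall>u<length (crossings D). touches D u w \<longrightarrow> (v, u) \<in> r))"

definition edge_letter :: "'a pd \<Rightarrow> (nat \<times> nat) set set \<Rightarrow> nat rel \<Rightarrow> edge \<Rightarrow> letter" where
  "edge_letter D S r e =
     (if snd e \<in> S then (if lowest D r e then Letter_L else Letter_D)
      else (if lowest D r e then Letter_l else Letter_d))"

fun specialize :: "letter \<Rightarrow> bool \<Rightarrow> laurent" where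
  "specialize Letter_L barred = (if barred then - A_pow 3 else - A_pow (-3))"
| "specialize Letter_l barred = (if barred then - A_pow (-3) else - A_pow 3)"
| "specialize Letter_D barred = (if barred then A_pow (-1) else A_pow 1)"
| "specialize Letter_d barred = (if barred then A_pow 1 else A_pow (-1))"

definition edge_weight :: "'a pd \<Rightarrow> (nat \<times> nat) set set \<Rightarrow> nat rel \<Rightarrow> edge \<Rightarrow> laurent" where
  "edge_weight D S r e = specialize (edge_letter D S r e) (\<not> positive_crossing D S (fst e))"

definition partition_function ::
    "'a pd \<Rightarrow> (nat \<times> nat) set set \<Rightarrow> (nat \<times> nat) set set \<Rightarrow> nat rel \<Rightarrow> laurent" where
  "partition_function D S W r =
     (\<Sum>P | perfect_matching {..<length (crossings D)} W (tait_edges D W) P.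
        \<Prod>e\<in>P. edge_weight D S r e)"

text \<open>For connected diagrams there is exactly one checkerboard coloring \<open>S\<close> with unshaded
  outside face, so only the omitted faces and the order are a matter of choice.\<close>

definition admits_dimer_model :: "'a pd \<Rightarrow> nat \<times> nat \<Rightarrow> bool" where
  "admits_dimer_model D out \<longleftrightarrow>
     (\<exists>S v2 v3 r. checkerboard D out S \<and>
        v2 \<in> S \<and> v3 \<in> faces D - S \<and> touch_along_strand D v2 v3 \<and>
        linear_order_on {..<length (crossings D)} r \<and>
        partition_function D S (faces D - {v2, v3}) r = bracket D)"


section \<open>Closed braids\<close>

text \<open>\<open>(i, True)\<close> stands for \<open>\<sigma>\<^sub>i\<close> and \<open>(i, False)\<close> for its inverse; \<open>i\<close> starts from 1.\<close>

type_synonym braid_word = "(nat \<times> bool) list"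

definition generator_power :: "nat \<Rightarrow> int \<Rightarrow> braid_word" where
  "generator_power i m = replicate (nat \<bar>m\<bar>) (i, m > 0)"

text \<open>The label \<open>(k, j)\<close> marks the point in position \<open>j\<close> at height \<open>k\<close>, where heights are
  counted downwards from 0 and the \<open>k\<close>-th letter of the word lies between heights \<open>k\<close> and
  \<open>k + 1\<close>. In \<open>\<sigma>\<^sub>i\<close> the over-strand runs from top right to bottom left.\<close>

definition braid_crossing :: "nat \<Rightarrow> nat \<times> bool \<Rightarrow> (nat \<times> nat) crossing" where
  "braid_crossing k = (\<lambda>(i, positive).
     if positive then Crossing (k, i) (k + 1, i) (k + 1, i + 1) (k, i + 1)
     else Crossing (k, i + 1) (k, i) (k + 1, i) (k + 1, i + 1))"

definition vertical_strands :: "nat \<Rightarrow> nat \<Rightarrow> nat \<Rightarrow> ((nat \<times> nat) \<times> (nat \<times> nat)) list" where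
  "vertical_strands n k i = [((k, j), (k + 1, j)). j \<leftarrow> [1..<n + 1], j \<noteq> i \<and> j \<noteq> i + 1]"

definition closure_strands :: "nat \<Rightarrow> nat \<Rightarrow> ((nat \<times> nat) \<times> (nat \<times> nat)) list" where
  "closure_strands n N = [((N, j), (0, j)). j \<leftarrow> [1..<n + 1]]"

definition braid_closure :: "nat \<Rightarrow> braid_word \<Rightarrow> (nat \<times> nat) pd" where
  "braid_closure n w = PD
     [braid_crossing k (w ! k). k \<leftarrow> [0..<length w]]
     (concat [vertical_strands n k (fst (w ! k)). k \<leftarrow> [0..<length w]]
      @ closure_strands n (length w))"

text \<open>The closing arcs run on the right of the braid, so the outside face lies to the left of
  position 1 and contains the left corner of every \<open>\<sigma>\<^sub>1\<close> and of every inverse of \<open>\<sigma>\<^sub>1\<close>. We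
  take the first of them; this makes sense for words containing such a letter. The left corner
  is the one between the top left and the bottom left end.\<close>

definition closure_outer_corner :: "braid_word \<Rightarrow> nat \<times> nat" where
  "closure_outer_corner w =
     (let k = (LEAST k. k < length w \<and> fst (w ! k) = 1) in (k, if snd (w ! k) then 0 else 1))"

end

theory Submission
  imports Defs "HOL-Library.FuncSet"
begin

text \<open>The crossings of \<open>\<sigma>\<^sub>i\<close> form one vertical twist region, called column \<open>i\<close>. Successive columns
interact very little: the diagram is a connected sum of closures of the two-strand braids
\<open>\<sigma>\<^sub>1\<^bsup>e m\<^esup>\<close>, one for each column. Both sides of the claimed equation therefore split
into one factor per column, and the factors agree. Throughout, \<open>e\<close> is \<open>1\<close> for positive and
\<open>-1\<close> for negative exponents, and \<open>m\<close> is the number of crossings in the column under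
consideration.

The bracket. Write \<open>1\<close> for the trivial two-strand tangle and \<open>U\<close> for the cup-cap. Resolving the
crossings of a column one by one, and removing a kink whenever a crossing meets a cup, gives
\<open>\<sigma>\<^bsup>e m\<^esup> = A\<^bsup>e m\<^esup> \<cdot> 1 + c\<^sub>m \<cdot> U\<close> with
\<open>c\<^sub>m = \<Sum>j<m. A\<^bsup>-e\<^esup> (-A\<^bsup>-3e\<^esup>)\<^bsup>j\<^esup> (A\<^bsup>e\<^esup>)\<^bsup>m-1-j\<^esup>\<close> (\<open>bracket_twist_region\<close>). In the closed braid the
first term splits off a circle, of value \<open>\<delta> = -A\<^sup>2 - A\<^sup>-\<^sup>2\<close>, and the second one does not; in
both cases what is left is the closure of the remaining columns. So the column contributes the
factor \<open>A\<^bsup>e m\<^esup> \<delta> + c\<^sub>m\<close> (\<open>bracket_diagram\<close>).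

The matchings. Between strand positions \<open>i\<close> and \<open>i + 1\<close> there are the bigons between successive
crossings of column \<open>i\<close>, and one big face, which goes around through the closing arcs; there is
also a big face \<open>0\<close>, the outside, and a big face \<open>n\<close>. A crossing of column \<open>i\<close> touches the big
faces of columns \<open>i - 1\<close> and \<open>i + 1\<close>, and, above and below, the two neighbouring faces of
column \<open>i\<close>. Omit the big faces \<open>0\<close> and \<open>1\<close>. By induction on \<open>i\<close>, the big faces \<open>i - 1\<close> and
\<open>i\<close> are not available to column \<open>i\<close>, and its bigons are one fewer than its crossings; so exactly
one crossing of the column is matched with the big face \<open>i + 1\<close>, the crossings above it must take
the bigons below them, and the crossings below it must take the bigons above them
(\<open>perfect_matching_choice\<close>). Hence a perfect matching is a free choice of one crossing in each
column.

The weights. Order the crossings from top to bottom. Then the edge from a crossing to the bigon below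
it is active, the edge to the bigon above it is not, and the edge to the big face \<open>i + 1\<close> is
active for the first crossing of the column only. Passing to the next column interchanges shaded with
unshaded faces and also positive with negative crossings, and the specialization is built so that
these two changes cancel; reversing all exponents replaces \<open>A\<close> by \<open>A\<^sup>-\<^sup>1\<close>. So choosing the crossing
with \<open>j\<close> crossings of its column above it gives the \<open>j\<close>-th term of \<open>c\<^sub>m\<close>, except that for
\<open>j = 0\<close> the leading \<open>A\<^bsup>-e\<^esup>\<close> becomes \<open>-A\<^bsup>3e\<^esup>\<close>. The sum of the weights is therefore
\<open>c\<^sub>m - (A\<^bsup>3e\<^esup> + A\<^bsup>-e\<^esup>) A\<^bsup>e(m-1)\<^esup> = c\<^sub>m + A\<^bsup>e m\<^esup> \<delta>\<close> (\<open>sum_choice_weight\<close>).\<close>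

section \<open>Powers of A\<close>

lemma A_pow_mult: "A_pow a * A_pow b = A_pow (a + b)"
  by (simp add: A_pow_def Poly_Mapping.mult_single)

lemma A_pow_0: "A_pow 0 = 1"
  by (simp add: A_pow_def)

lemma A_pow_power: "A_pow a ^ k = A_pow (int k * a)"
  by (induction k) (simp_all add: A_pow_0 A_pow_mult algebra_simps)

definition loop_value :: laurent where
  "loop_value = - A_pow 2 - A_pow (-2)"

section \<open>Brackets of diagrams with crossingless strands\<close>

definition labels :: "'a crossing list \<Rightarrow> 'a set" where
  "labels Xs = (\<Union>X\<in>set Xs. set_crossing X)"

lemma labels_simps [simp]:
  "labels [] = {}"
  "labels (Crossing a b c d # Xs) = {a, b, c, d} \<union> labels Xs"
  "labels (Xs @ Ys) = labels Xs \<union> labels Ys"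
  by (auto simp: labels_def)

lemma connected_by_refl [simp]: "(x, x) \<in> connected_by S"
  by (simp add: connected_by_def)

lemma connected_by_sym: "(x, y) \<in> connected_by S \<Longrightarrow> (y, x) \<in> connected_by S"
  unfolding connected_by_def by (meson sym_Un_converse sym_rtrancl symD)

lemma connected_by_trans:
  "(x, y) \<in> connected_by S \<Longrightarrow> (y, z) \<in> connected_by S \<Longrightarrow> (x, z) \<in> connected_by S"
  unfolding connected_by_def by (rule rtrancl_trans)

lemma connected_by_join: "(x, y) \<in> set S \<Longrightarrow> (x, y) \<in> connected_by S"
  unfolding connected_by_def by auto

lemma connected_by_join_rev: "(x, y) \<in> set S \<Longrightarrow> (y, x) \<in> connected_by S"
  by (rule connected_by_sym) (rule connected_by_join)

lemma connected_by_mono: "set S \<subseteq> set S' \<Longrightarrow> connected_by S \<subseteq> connected_by S'"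
  unfolding connected_by_def by (rule rtrancl_mono) auto

lemma connected_by_subsetI:
  assumes "\<And>x y. (x, y) \<in> set S \<Longrightarrow> (x, y) \<in> connected_by S'"
  shows "connected_by S \<subseteq> connected_by S'"
proof (rule subrelI)
  fix x y assume "(x, y) \<in> connected_by S"
  then show "(x, y) \<in> connected_by S'"
    unfolding connected_by_def[of S]
    by (induction rule: rtrancl_induct)
      (auto intro: connected_by_trans connected_by_sym dest: assms)
qed

lemma connected_by_eqI:
  assumes "\<And>x y. (x, y) \<in> set S \<Longrightarrow> (x, y) \<in> connected_by S'"
    and "\<And>x y. (x, y) \<in> set S' \<Longrightarrow> (x, y) \<in> connected_by S"
  shows "connected_by S = connected_by S'"
  using connected_by_subsetI[of S S'] connected_by_subsetI[of S' S] assms by blast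

lemma connected_by_append_cong:
  assumes "connected_by S = connected_by S'"
  shows "connected_by (T @ S) = connected_by (T @ S')"
  by (rule connected_by_eqI)
    (use assms connected_by_mono[of S "T @ S"] connected_by_mono[of S' "T @ S'"]
      in \<open>auto intro: connected_by_join\<close>)

text \<open>The joins enter the bracket only through the number of circles of each state, so only the
partition of the labels that they generate matters. Labels of crossings always end up in the field of
the joins; hence adding or dropping a loop \<open>(a, a)\<close> is harmless if \<open>a\<close> occurs elsewhere, while
an isolated loop is an extra circle.\<close>
lemma bracket_cong_connected:
  assumes "connected_by S = connected_by S'"
    and "Field (set S) \<union> labels Xs = Field (set S') \<union> labels Xs"
  shows "bracket (PD Xs S) = bracket (PD Xs S')"
  using assms
proof (induction Xs arbitrary: S S')
  case Nil
  then show ?case by (simp add: circles_def)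
next
  case (Cons x Xs)
  obtain a b c d where x: "x = Crossing a b c d" by (cases x)
  have "bracket (PD Xs ([(p, q), (r, t)] @ S)) = bracket (PD Xs ([(p, q), (r, t)] @ S'))"
    if "{p, q, r, t} = {a, b, c, d}" for p q r t
    by (rule Cons.IH, rule connected_by_append_cong, rule Cons.prems(1))
      (use Cons.prems(2) that in \<open>simp add: x, blast\<close>)
  from this[of a b c d] this[of b c d a] show ?case
    by (simp add: x insert_commute)
qed

lemma card_image_eqI:
  assumes "\<And>x y. x \<in> A \<Longrightarrow> y \<in> A \<Longrightarrow> F x = F y \<longleftrightarrow> G x = G y"
  shows "card (F ` A) = card (G ` A)"
proof (rule bij_betw_same_card)
  show "bij_betw (\<lambda>c. G (inv_into A F c)) (F ` A) (G ` A)"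
    unfolding bij_betw_def
  proof
    have inv: "inv_into A F (F x) \<in> A" "F (inv_into A F (F x)) = F x" if "x \<in> A" for x
      using that by (auto intro: inv_into_into f_inv_into_f)
    then have G: "G (inv_into A F (F x)) = G x" if "x \<in> A" for x
      using assms that by blast
    show "inj_on (\<lambda>c. G (inv_into A F c)) (F ` A)"
      by (rule inj_onI) (auto simp: G assms)
    show "(\<lambda>c. G (inv_into A F c)) ` F ` A = G ` A"
      unfolding image_image by (rule image_cong) (simp_all add: G)
  qed
qed

text \<open>A path between images lifts step by step, because two preimages of a point are connected already; so
no two components are merged.\<close>
lemma circles_collapse:
  assumes f: "\<And>x y. x \<in> K \<Longrightarrow> y \<in> K \<Longrightarrow> f x = f y \<Longrightarrow> (x, y) \<in> connected_by S"
    and K: "Field (set S) \<subseteq> K"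
  shows "circles (map (map_prod f f) S) = circles S"
proof -
  let ?S = "map (map_prod f f) S"
  have ker: "connected_by T `` {x} = connected_by T `` {y} \<longleftrightarrow> (x, y) \<in> connected_by T"
    for T :: "('c \<times> 'c) list" and x y
    by (auto dest: connected_by_sym connected_by_trans)
  have Fld: "Field (set ?S) = f ` Field (set S)"
    by (force simp: Field_def)
  have down: "(f x, f y) \<in> connected_by ?S" if "(x, y) \<in> connected_by S" for x y
    using that unfolding connected_by_def[of S]
  proof (induction rule: rtrancl_induct)
    case (step y z)
    then have "(f y, f z) \<in> set ?S \<or> (f z, f y) \<in> set ?S" by force
    with step.IH show ?case by (meson connected_by_join connected_by_sym connected_by_trans)
  qed simp
  have up: "\<exists>y\<in>K. v = f y \<and> (x, y) \<in> connected_by S"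
    if "(f x, v) \<in> connected_by ?S" "x \<in> K" for x v
    using that(1) unfolding connected_by_def[of ?S]
  proof (induction rule: rtrancl_induct)
    case base
    then show ?case using that(2) by auto
  next
    case (step v u)
    then obtain y where y: "y \<in> K" "v = f y" "(x, y) \<in> connected_by S" by blast
    from step.hyps(2) obtain p q where pq: "v = f p" "u = f q" "(p, q) \<in> set S \<or> (q, p) \<in> set S"
      by auto
    then have "p \<in> K" "q \<in> K" using K by (auto simp: Field_def)
    moreover have "(p, q) \<in> connected_by S"
      using pq(3) by (meson connected_by_join connected_by_sym)
    ultimately show ?case using y pq f by (metis connected_by_trans)
  qed
  have iff: "(x, y) \<in> connected_by S \<longleftrightarrow> (f x, f y) \<in> connected_by ?S" if "x \<in> K" "y \<in> K" for x y
    using down up f that by (metis connected_by_trans)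
  have "card ((\<lambda>x. connected_by S `` {x}) ` Field (set S)) =
      card ((\<lambda>x. connected_by ?S `` {f x}) ` Field (set S))"
    by (rule card_image_eqI) (use K iff in \<open>auto simp: ker\<close>)
  then show ?thesis
    unfolding circles_def Fld by (simp add: quotient_def image_image UNION_singleton_eq_range)
qed

text \<open>Relabelling by a function that merges only points of the same strand is an isotopy. This is what
turns combinatorial strands with many intermediate points into strands with a single label.\<close>
lemma bracket_collapse:
  assumes "\<And>x y. x \<in> K \<Longrightarrow> y \<in> K \<Longrightarrow> f x = f y \<Longrightarrow> (x, y) \<in> connected_by S"
    and "Field (set S) \<union> labels Xs \<subseteq> K"
  shows "bracket (PD Xs S) = bracket (PD (map (map_crossing f) Xs) (map (map_prod f f) S))"
  using assms
proof (induction Xs arbitrary: S)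
  case Nil
  then show ?case by (simp add: circles_collapse[of K])
next
  case (Cons x Xs)
  obtain a b c d where x: "x = Crossing a b c d" by (cases x)
  have "bracket (PD Xs ((p, q) # (r, t) # S)) =
      bracket (PD (map (map_crossing f) Xs) (map (map_prod f f) ((p, q) # (r, t) # S)))"
    if "{p, q, r, t} = {a, b, c, d}" for p q r t
  proof (rule Cons.IH)
    show "(u, v) \<in> connected_by ((p, q) # (r, t) # S)" if "u \<in> K" "v \<in> K" "f u = f v" for u v
      using Cons.prems(1)[OF that] connected_by_mono[of S "(p, q) # (r, t) # S"] by auto
    have "{p, q, r, t} \<union> (Field (set S) \<union> labels Xs) \<subseteq> K"
      using Cons.prems(2) unfolding that by (simp add: x)
    then show "Field (set ((p, q) # (r, t) # S)) \<union> labels Xs \<subseteq> K" by simp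
  qed
  from this[of a b c d] this[of b c d a] show ?case
    by (simp add: x insert_commute)
qed

lemma map_crossing_fresh:
  assumes "\<And>x. x \<in> labels Xs \<Longrightarrow> f x = x"
  shows "map (map_crossing f) Xs = Xs"
  by (rule map_idI) (use assms in \<open>auto simp: labels_def intro: crossing.map_ident_strong\<close>)

lemma map_joins_fresh:
  assumes "\<And>x. x \<in> Field (set S) \<Longrightarrow> f x = x"
  shows "map (map_prod f f) S = S"
  by (rule map_idI) (auto intro!: assms intro: FieldI1 FieldI2)

lemma bracket_contract:
  assumes "a \<notin> labels Xs \<union> Field (set S)" "a \<noteq> b" "a \<noteq> c"
  shows "bracket (PD Xs ((a, b) # (a, c) # S)) = bracket (PD Xs ((b, c) # S))"
proof -
  let ?f = "id (a := b)"
  have "bracket (PD Xs ((a, b) # (a, c) # S)) =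
      bracket (PD (map (map_crossing ?f) Xs) (map (map_prod ?f ?f) ((a, b) # (a, c) # S)))"
    by (rule bracket_collapse[where K = UNIV])
      (auto split: if_splits intro: connected_by_join connected_by_join_rev)
  also have "\<dots> = bracket (PD Xs ((b, b) # (b, c) # S))"
  proof -
    have "map (map_crossing ?f) Xs = Xs"
      by (rule map_crossing_fresh) (use assms in auto)
    moreover have "map (map_prod ?f ?f) S = S"
      by (rule map_joins_fresh) (use assms in auto)
    ultimately show ?thesis using assms by simp
  qed
  also have "\<dots> = bracket (PD Xs ((b, c) # S))"
    by (rule bracket_cong_connected, rule connected_by_eqI) (auto intro: connected_by_join)
  finally show ?thesis .
qed

text \<open>A join between two points that meet nothing else counts as a circle; the case \<open>a = c\<close> is included.\<close>
lemma bracket_split_circle: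
  assumes "a \<notin> labels Xs \<union> Field (set S)" "c \<notin> labels Xs \<union> Field (set S)"
    and "Xs \<noteq> [] \<or> S \<noteq> []"
  shows "bracket (PD Xs ((a, c) # S)) = loop_value * bracket (PD Xs S)"
proof -
  let ?f = "id (a := c)"
  have "bracket (PD Xs ((a, c) # S)) =
      bracket (PD (map (map_crossing ?f) Xs) (map (map_prod ?f ?f) ((a, c) # S)))"
    by (rule bracket_collapse[where K = UNIV])
      (auto split: if_splits intro: connected_by_join connected_by_join_rev)
  also have "\<dots> = bracket (PD Xs ((c, c) # S))"
  proof -
    have "map (map_crossing ?f) Xs = Xs"
      by (rule map_crossing_fresh) (use assms in auto)
    moreover have "map (map_prod ?f ?f) S = S"
      by (rule map_joins_fresh) (use assms in auto)
    ultimately show ?thesis using assms by simp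
  qed
  also have "\<dots> = loop_value * bracket (PD Xs S)"
    unfolding loop_value_def
    by (rule bracket_disjoint_circle) (use assms in \<open>auto simp: labels_def\<close>)
  finally show ?thesis .
qed

lemma bracket_joins_cong:
  assumes "set S \<union> (set S)\<inverse> = set S' \<union> (set S')\<inverse>"
  shows "bracket (PD Xs S) = bracket (PD Xs S')"
proof (rule bracket_cong_connected)
  show "connected_by S = connected_by S'" using assms by (simp add: connected_by_def)
  have "Field R = Domain (R \<union> R\<inverse>)" for R :: "'a rel" by (auto simp: Field_def)
  then show "Field (set S) \<union> labels Xs = Field (set S') \<union> labels Xs"
    using assms by metis
qed

section \<open>Twist regions\<close>

definition twist_sign :: "bool \<Rightarrow> int" where
  "twist_sign pos = (if pos then 1 else -1)"

text \<open>The arguments are the ends at the northwest, southwest, southeast and northeast.\<close>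
definition twist_crossing :: "bool \<Rightarrow> 'a \<Rightarrow> 'a \<Rightarrow> 'a \<Rightarrow> 'a \<Rightarrow> 'a crossing" where
  "twist_crossing pos nw sw se ne =
     (if pos then Crossing nw sw se ne else Crossing ne nw sw se)"

lemma labels_twist_crossing [simp]:
  "labels (twist_crossing pos nw sw se ne # Xs) = {nw, sw, se, ne} \<union> labels Xs"
  by (auto simp: twist_crossing_def)

text \<open>For a negative crossing the two smoothings change roles, which amounts to inverting \<open>A\<close>. Stating
the skein relation in terms of the vertical and the horizontal smoothing treats both signs at once.\<close>
lemma bracket_twist_crossing:
  "bracket (PD (twist_crossing pos nw sw se ne # Xs) S) =
     A_pow (twist_sign pos) * bracket (PD Xs ((nw, sw) # (ne, se) # S)) +
     A_pow (- twist_sign pos) * bracket (PD Xs ((nw, ne) # (sw, se) # S))"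
proof -
  have "bracket (PD Xs ((nw, sw) # (se, ne) # S)) = bracket (PD Xs ((nw, sw) # (ne, se) # S))"
    "bracket (PD Xs ((sw, se) # (ne, nw) # S)) = bracket (PD Xs ((nw, ne) # (sw, se) # S))"
    "bracket (PD Xs ((ne, nw) # (sw, se) # S)) = bracket (PD Xs ((nw, ne) # (sw, se) # S))"
    by (rule bracket_joins_cong; auto)+
  then show ?thesis by (simp add: twist_crossing_def twist_sign_def)
qed

definition twist_region :: "bool \<Rightarrow> (nat \<Rightarrow> 'a) \<Rightarrow> (nat \<Rightarrow> 'a) \<Rightarrow> nat \<Rightarrow> 'a crossing list" where
  "twist_region pos x y m =
     map (\<lambda>t. twist_crossing pos (x t) (x (Suc t)) (y (Suc t)) (y t)) [0..<m]"

text \<open>The coefficient of the cup-cap in the expansion of \<open>m\<close> half twists.\<close>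
definition twist_coeff :: "int \<Rightarrow> nat \<Rightarrow> laurent" where
  "twist_coeff e m = (\<Sum>j<m. A_pow (- e) * (- A_pow (-3 * e)) ^ j * A_pow e ^ (m - 1 - j))"

lemma twist_coeff_0 [simp]: "twist_coeff e 0 = 0"
  by (simp add: twist_coeff_def)

lemma twist_coeff_Suc:
  "twist_coeff e (Suc m) = A_pow (- e) * A_pow e ^ m - A_pow (-3 * e) * twist_coeff e m"
  unfolding twist_coeff_def
  by (subst sum.lessThan_Suc_shift) (simp add: sum_distrib_left sum_negf algebra_simps)

lemma loop_value_twist_sign:
  "loop_value = - A_pow (2 * twist_sign pos) - A_pow (- 2 * twist_sign pos)"
  by (simp add: loop_value_def twist_sign_def)

text \<open>The effect of removing a kink: one smoothing of its crossing straightens the strand, and the other one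
splits off a circle.\<close>
lemma kink_removal:
  "A_pow (twist_sign pos) + A_pow (- twist_sign pos) * loop_value = - A_pow (-3 * twist_sign pos)"
  unfolding loop_value_twist_sign[of pos]
  by (simp add: right_diff_distrib A_pow_mult)

text \<open>Induction on \<open>m\<close>, resolving the last crossing. If the crossings before it became two vertical
strands, then its smoothings give two vertical strands and a cup-cap; if they became a cup-cap, then
it is a kink. The freshness assumptions say that the intermediate points of the region occur
nowhere else; the four end points may coincide with each other and with other labels.\<close>
lemma bracket_twist_region:
  assumes "m > 0"
    and "\<And>t. 0 < t \<Longrightarrow> t < m \<Longrightarrow> {x t, y t} \<inter> (labels Xs \<union> Field (set S)) = {}"
    and "\<And>t u. 0 < t \<Longrightarrow> t < m \<Longrightarrow> u \<le> m \<Longrightarrow> x t \<noteq> y u \<and> y t \<noteq> x u"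
    and "\<And>t u. 0 < t \<Longrightarrow> t < m \<Longrightarrow> u \<le> m \<Longrightarrow> u \<noteq> t \<Longrightarrow> x t \<noteq> x u \<and> y t \<noteq> y u"
  shows "bracket (PD (twist_region pos x y m @ Xs) S) =
     A_pow (twist_sign pos) ^ m * bracket (PD Xs ((x 0, x m) # (y 0, y m) # S)) +
     twist_coeff (twist_sign pos) m * bracket (PD Xs ((x 0, y 0) # (x m, y m) # S))"
  using assms
proof (induction m arbitrary: Xs rule: nat_induct_non_zero)
  case 1
  then show ?case
    by (simp add: twist_region_def bracket_twist_crossing twist_coeff_Suc)
next
  case (Suc m)
  let ?e = "twist_sign pos"
  let ?X = "twist_crossing pos (x m) (x (Suc m)) (y (Suc m)) (y m)"
  let ?x' = "x (Suc m)" and ?y' = "y (Suc m)"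
  note fresh = Suc.prems(1)[of m] and xy = Suc.prems(2)[of m] and ne = Suc.prems(3)[of m]
  have xym: "x m \<noteq> y m" using xy[of m] Suc.hyps by simp
  have "bracket (PD (twist_region pos x y (Suc m) @ Xs) S) =
      bracket (PD (twist_region pos x y m @ ?X # Xs) S)"
    by (simp add: twist_region_def)
  also have "\<dots> =
      A_pow ?e ^ m * bracket (PD (?X # Xs) ((x 0, x m) # (y 0, y m) # S)) +
      twist_coeff ?e m * bracket (PD (?X # Xs) ((x 0, y 0) # (x m, y m) # S))"
  proof (rule Suc.IH, goal_cases)
    case (1 t)
    with Suc.prems(1)[of t] Suc.prems(2)[of t m] Suc.prems(2)[of t "Suc m"]
      Suc.prems(3)[of t m] Suc.prems(3)[of t "Suc m"]
    show ?case by auto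
  next
    case (2 t u)
    then show ?case using Suc.prems(2)[of t u] by simp
  next
    case (3 t u)
    then show ?case using Suc.prems(3)[of t u] by simp
  qed
  also have "bracket (PD (?X # Xs) ((x 0, x m) # (y 0, y m) # S)) =
      A_pow ?e * bracket (PD Xs ((x 0, ?x') # (y 0, ?y') # S)) +
      A_pow (- ?e) * bracket (PD Xs ((x 0, y 0) # (?x', ?y') # S))"
  proof -
    have "bracket (PD Xs ((x m, ?x') # (y m, ?y') # (x 0, x m) # (y 0, y m) # S)) =
        bracket (PD Xs ((x m, x 0) # (x m, ?x') # (y m, ?y') # (y 0, y m) # S))"
      by (rule bracket_joins_cong) auto
    also have "\<dots> = bracket (PD Xs ((x 0, ?x') # (y m, ?y') # (y 0, y m) # S))"
      by (rule bracket_contract) (use Suc.hyps fresh xy ne xym in force)+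
    also have "\<dots> = bracket (PD Xs ((y m, y 0) # (y m, ?y') # (x 0, ?x') # S))"
      by (rule bracket_joins_cong) auto
    also have "\<dots> = bracket (PD Xs ((y 0, ?y') # (x 0, ?x') # S))"
      by (rule bracket_contract) (use Suc.hyps fresh xy ne xym in force)+
    also have "\<dots> = bracket (PD Xs ((x 0, ?x') # (y 0, ?y') # S))"
      by (rule bracket_joins_cong) auto
    finally have V: "bracket (PD Xs ((x m, ?x') # (y m, ?y') # (x 0, x m) # (y 0, y m) # S)) = \<dots>" .
    have "bracket (PD Xs ((x m, y m) # (?x', ?y') # (x 0, x m) # (y 0, y m) # S)) =
        bracket (PD Xs ((x m, x 0) # (x m, y m) # (?x', ?y') # (y 0, y m) # S))"
      by (rule bracket_joins_cong) auto
    also have "\<dots> = bracket (PD Xs ((x 0, y m) # (?x', ?y') # (y 0, y m) # S))"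
      by (rule bracket_contract) (use Suc.hyps fresh xy ne xym in force)+
    also have "\<dots> = bracket (PD Xs ((y m, x 0) # (y m, y 0) # (?x', ?y') # S))"
      by (rule bracket_joins_cong) auto
    also have "\<dots> = bracket (PD Xs ((x 0, y 0) # (?x', ?y') # S))"
      by (rule bracket_contract) (use Suc.hyps fresh xy ne xym in force)+
    finally show ?thesis by (simp add: bracket_twist_crossing V)
  qed
  also have "bracket (PD (?X # Xs) ((x 0, y 0) # (x m, y m) # S)) =
      - A_pow (-3 * ?e) * bracket (PD Xs ((x 0, y 0) # (?x', ?y') # S))"
  proof -
    have "bracket (PD Xs ((x m, ?x') # (y m, ?y') # (x 0, y 0) # (x m, y m) # S)) =
        bracket (PD Xs ((x m, ?x') # (x m, y m) # (y m, ?y') # (x 0, y 0) # S))"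
      by (rule bracket_joins_cong) auto
    also have "\<dots> = bracket (PD Xs ((?x', y m) # (y m, ?y') # (x 0, y 0) # S))"
      by (rule bracket_contract) (use Suc.hyps fresh xy ne xym in force)+
    also have "\<dots> = bracket (PD Xs ((y m, ?x') # (y m, ?y') # (x 0, y 0) # S))"
      by (rule bracket_joins_cong) auto
    also have "\<dots> = bracket (PD Xs ((?x', ?y') # (x 0, y 0) # S))"
      by (rule bracket_contract) (use Suc.hyps fresh xy ne xym in force)+
    also have "\<dots> = bracket (PD Xs ((x 0, y 0) # (?x', ?y') # S))"
      by (rule bracket_joins_cong) auto
    finally have V: "bracket (PD Xs ((x m, ?x') # (y m, ?y') # (x 0, y 0) # (x m, y m) # S)) = \<dots>" .
    have "bracket (PD Xs ((x m, y m) # (?x', ?y') # (x 0, y 0) # (x m, y m) # S)) =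
        bracket (PD Xs ((x m, y m) # (x 0, y 0) # (?x', ?y') # S))"
      by (rule bracket_joins_cong) auto
    also have "\<dots> = loop_value * bracket (PD Xs ((x 0, y 0) # (?x', ?y') # S))"
      by (rule bracket_split_circle) (use Suc.hyps fresh xy ne xym in force)+
    finally have C: "bracket (PD Xs ((x m, y m) # (?x', ?y') # (x 0, y 0) # (x m, y m) # S)) = \<dots>" .
    show ?thesis
      unfolding bracket_twist_crossing V C kink_removal[symmetric]
      by (simp only: distrib_right mult.assoc)
  qed
  finally show ?case
    by (simp add: twist_coeff_Suc algebra_simps)
qed

section \<open>The braid, its columns and its strands\<close>

locale twist_braid =
  fixes n :: nat and M :: "nat \<Rightarrow> nat" and pos :: bool
  assumes n_ge_2: "n \<ge> 2"
    and M_pos: "1 \<le> i \<Longrightarrow> i < n \<Longrightarrow> M i > 0"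
    and M_0: "i = 0 \<or> n \<le> i \<Longrightarrow> M i = 0"
begin

text \<open>Column \<open>p\<close> consists of the crossings \<open>start p, \<dots>, start (Suc p) - 1\<close>, which is empty unless
\<open>1 \<le> p < n\<close>.\<close>
definition start :: "nat \<Rightarrow> nat" where
  "start p = sum M {..<p}"

definition word :: braid_word where
  "word = concat (map (\<lambda>i. replicate (M i) (i, pos)) [1..<n])"

definition column :: "nat \<Rightarrow> nat" where
  "column k = fst (word ! k)"

abbreviation "N \<equiv> start n"

abbreviation "diagram \<equiv> braid_closure n word"

lemma start_0 [simp]: "start 0 = 0"
  and start_Suc: "start (Suc p) = start p + M p"
  by (simp_all add: start_def)

lemma start_1 [simp]: "start (Suc 0) = 0"
  by (simp add: start_Suc M_0)

lemma start_mono: "p \<le> q \<Longrightarrow> start p \<le> start q"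
  by (auto simp: start_def intro: sum_mono2)

lemma start_beyond: "n \<le> p \<Longrightarrow> start p = N"
  by (induction p rule: dec_induct) (simp_all add: start_Suc M_0)

lemma start_le_N: "start p \<le> N"
  using start_mono[of p n] start_beyond[of p] by fastforce

lemma start_less: "1 \<le> p \<Longrightarrow> p < n \<Longrightarrow> start p < start (Suc p)"
  using M_pos by (simp add: start_Suc)

lemma word_prefix:
  assumes "q \<ge> 1"
  defines "W \<equiv> concat (map (\<lambda>i. replicate (M i) (i, pos)) [1..<q])"
  shows "length W = start q \<and>
    (\<forall>k<start q. \<exists>i. 1 \<le> i \<and> i < q \<and> start i \<le> k \<and> k < start (Suc i) \<and> W ! k = (i, pos))"
  using assms(1) unfolding W_def
proof (induction q rule: nat_induct_at_least)
  case (Suc q)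
  let ?W = "concat (map (\<lambda>i. replicate (M i) (i, pos)) [1..<q])"
  have eq: "concat (map (\<lambda>i. replicate (M i) (i, pos)) [1..<Suc q]) = ?W @ replicate (M q) (q, pos)"
    using Suc.hyps by simp
  have len: "length ?W = start q" using Suc.IH by blast
  show ?case unfolding eq
  proof (intro conjI allI impI)
    fix k assume k: "k < start (Suc q)"
    show "\<exists>i. 1 \<le> i \<and> i < Suc q \<and> start i \<le> k \<and> k < start (Suc i) \<and>
        (?W @ replicate (M q) (q, pos)) ! k = (i, pos)"
    proof (cases "k < start q")
      case True
      with Suc.IH obtain i where "1 \<le> i" "i < q" "start i \<le> k" "k < start (Suc i)" "?W ! k = (i, pos)"
        by blast
      with True len show ?thesis by (intro exI[of _ i]) (simp add: nth_append)
    next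
      case False
      with k Suc.hyps len show ?thesis
        by (intro exI[of _ q]) (simp add: nth_append start_Suc)
    qed
  qed (use len in \<open>simp add: start_Suc\<close>)
qed simp

lemma length_word [simp]: "length word = N"
  using word_prefix[of n] n_ge_2 by (simp add: word_def)

lemma column_spec:
  assumes "k < N"
  shows "word ! k = (column k, pos)" "1 \<le> column k" "column k < n"
    "start (column k) \<le> k" "k < start (Suc (column k))"
proof -
  obtain i where "1 \<le> i" "i < n" "start i \<le> k" "k < start (Suc i)" "word ! k = (i, pos)"
    using word_prefix[of n] n_ge_2 assms unfolding word_def by auto
  then show "word ! k = (column k, pos)" "1 \<le> column k" "column k < n"
    "start (column k) \<le> k" "k < start (Suc (column k))"
    by (simp_all add: column_def)
qed

lemma column_less:
  assumes "k < N" "k < start p"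
  shows "column k < p"
  using column_spec(4)[OF assms(1)] assms(2) start_mono[of p "column k"] by linarith

lemma column_ge:
  assumes "k < N" "start p \<le> k"
  shows "p \<le> column k"
  using column_spec(5)[OF assms(1)] assms(2) start_mono[of "Suc (column k)" p] by linarith

lemma column_eqI:
  assumes "start i \<le> k" "k < start (Suc i)"
  shows "column k = i"
proof -
  have "k < N" using assms(2) start_le_N[of "Suc i"] by linarith
  then show ?thesis using column_less[of k "Suc i"] column_ge[of k i] assms by simp
qed

lemma N_pos: "0 < N"
  using start_less[of 1] n_ge_2 start_le_N[of 2] by (simp add: numeral_2_eq_2)

lemma crossings_diagram:
  "crossings diagram =
     map (\<lambda>k. twist_crossing pos (k, column k) (Suc k, column k) (Suc k, Suc (column k)) (k, Suc (column k)))
       [0..<N]"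
  by (auto simp: braid_closure_def braid_crossing_def twist_crossing_def column_spec(1))

lemma joins_diagram:
  "(x, y) \<in> set (joins diagram) \<longleftrightarrow>
     (\<exists>k p. k < N \<and> 1 \<le> p \<and> p \<le> n \<and> p \<noteq> column k \<and> p \<noteq> Suc (column k) \<and> x = (k, p) \<and> y = (Suc k, p)) \<or>
     (\<exists>p. 1 \<le> p \<and> p \<le> n \<and> x = (N, p) \<and> y = (0, p))"
  by (auto simp: braid_closure_def vertical_strands_def closure_strands_def column_def less_Suc_eq_le)

text \<open>A canonical point on the strand through position \<open>p\<close> at height \<open>h\<close>. The crossings that involve
position \<open>p\<close> are those of columns \<open>p - 1\<close> and \<open>p\<close>, and they are consecutive. So a height strictly
between two of them is alone on its strand, whereas all other heights are connected with each other
through the closing arc, and are represented by height \<open>0\<close>.\<close>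
definition strand :: "nat \<times> nat \<Rightarrow> nat \<times> nat" where
  "strand = (\<lambda>(h, p). (if start (p - 1) < h \<and> h < start (Suc p) then h else 0, p))"

definition points :: "(nat \<times> nat) set" where
  "points = {..N} \<times> {1..n}"

lemma strand_join:
  assumes "(x, y) \<in> set (joins diagram)"
  shows "strand x = (0, snd x)" "strand y = (0, snd x)"
proof -
  have "strand x = (0, snd x) \<and> strand y = (0, snd x)"
    using assms unfolding joins_diagram
  proof (elim disjE exE conjE)
    fix k p assume k: "k < N" and p: "1 \<le> p" "p \<noteq> column k" "p \<noteq> Suc (column k)"
      and xy: "x = (k, p)" "y = (Suc k, p)"
    show ?thesis
    proof (cases "p < column k")
      case True
      then have "start (Suc p) \<le> k"
        using start_mono[of "Suc p" "column k"] column_spec(4)[OF k] by simp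
      then show ?thesis by (simp add: xy strand_def)
    next
      case False
      then have "Suc (column k) \<le> p - 1" using p by linarith
      then have "Suc k \<le> start (p - 1)"
        using start_mono[of "Suc (column k)" "p - 1"] column_spec(5)[OF k] by simp
      then show ?thesis by (simp add: xy strand_def)
    qed
  qed (use start_le_N in \<open>auto simp: strand_def not_less\<close>)
  then show "strand x = (0, snd x)" "strand y = (0, snd x)" by auto
qed

lemma strand_connected:
  assumes "(x, y) \<in> connected_by (joins diagram)"
  shows "strand x = strand y"
  using assms unfolding connected_by_def
  by (induction rule: rtrancl_induct) (auto simp: strand_join)

text \<open>Above column \<open>p - 1\<close> one moves straight up to height \<open>0\<close>, and below column \<open>p\<close> straight down to
height \<open>N\<close> and around the closing arc: on the way no letter involves position \<open>p\<close>.\<close>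
lemma connected_to_top:
  assumes "1 \<le> p" "p \<le> n" "h \<le> N" "strand (h, p) = (0, p)"
  shows "((h, p), (0, p)) \<in> connected_by (joins diagram)"
proof (cases "h \<le> start (p - 1)")
  case True
  then show ?thesis
  proof (induction h)
    case (Suc h)
    have "h < N" using Suc.prems start_le_N[of "p - 1"] by simp
    moreover have "column h < p - 1" using \<open>h < N\<close> Suc.prems by (intro column_less) simp_all
    ultimately have "((h, p), (Suc h, p)) \<in> set (joins diagram)"
      using assms unfolding joins_diagram by auto
    with Suc show ?case by (meson connected_by_join_rev connected_by_trans Suc_leD)
  qed simp
next
  case False
  then have "start (Suc p) \<le> h" using assms(4) by (auto simp: strand_def split: if_splits)
  with \<open>h \<le> N\<close> have "((h, p), (N, p)) \<in> connected_by (joins diagram)"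
  proof (induction h rule: inc_induct)
    case (step h)
    then have "Suc p \<le> column h" by (intro column_ge) simp_all
    then have "((h, p), (Suc h, p)) \<in> set (joins diagram)"
      using assms step.hyps unfolding joins_diagram by auto
    with step show ?case by (meson connected_by_join connected_by_trans le_SucI)
  qed simp
  moreover have "((N, p), (0, p)) \<in> set (joins diagram)"
    using assms unfolding joins_diagram by auto
  ultimately show ?thesis by (meson connected_by_join connected_by_trans)
qed

lemma connected_iff_strand:
  assumes "x \<in> points" "y \<in> points"
  shows "(x, y) \<in> connected_by (joins diagram) \<longleftrightarrow> strand x = strand y"
proof
  assume eq: "strand x = strand y"
  obtain h p h' p' where xy: "x = (h, p)" "y = (h', p')" by (cases x, cases y)
  have p: "p' = p" using eq by (simp add: xy strand_def split: if_splits)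
  show "(x, y) \<in> connected_by (joins diagram)"
  proof (cases "strand x = (0, p)")
    case True
    with assms eq show ?thesis
      unfolding xy p points_def
      by (metis (no_types, lifting) connected_by_sym connected_by_trans connected_to_top
          atMost_iff atLeastAtMost_iff mem_Sigma_iff)
  next
    case False
    with eq have "h' = h" by (auto simp: xy p strand_def split: if_splits)
    then show ?thesis by (simp add: xy p)
  qed
qed (rule strand_connected)

definition strand_crossing :: "nat \<Rightarrow> (nat \<times> nat) crossing" where
  "strand_crossing k = twist_crossing pos (strand (k, column k)) (strand (Suc k, column k))
     (strand (Suc k, Suc (column k))) (strand (k, Suc (column k)))"

lemma labels_strand_crossings:
  "labels (map strand_crossing ks) =
     (\<Union>k\<in>set ks. {strand (k, column k), strand (Suc k, column k),
        strand (Suc k, Suc (column k)), strand (k, Suc (column k))})"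
  by (auto simp: labels_def strand_crossing_def twist_crossing_def split: if_splits)

lemma labels_diagram: "labels (crossings diagram) \<subseteq> points"
  using column_spec
  by (fastforce simp: crossings_diagram labels_def twist_crossing_def points_def split: if_splits)

lemma Field_diagram: "Field (set (joins diagram)) \<subseteq> points"
  by (auto simp: Field_def joins_diagram points_def)

lemma strand_top_in_labels:
  assumes "1 \<le> p" "p \<le> n"
  shows "(0, p) \<in> labels (map strand_crossing [0..<N])"
proof (cases "p < n")
  case True
  \<comment> \<open>The bottom left end of the last crossing of column \<open>p\<close> is on the closing arc.\<close>
  define k where "k = start (Suc p) - 1"
  have k: "start p \<le> k" "k < start (Suc p)" "Suc k = start (Suc p)"
    using start_less[of p] True assms by (simp_all add: k_def)
  then have "column k = p" "k < N" using column_eqI start_le_N[of "Suc p"] by simp_all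
  then show ?thesis using k unfolding labels_strand_crossings
    by (auto intro!: bexI[of _ k] simp: strand_def)
next
  case False
  \<comment> \<open>Position \<open>n\<close> has no column of its own; its closing arc starts at the last crossing of all.\<close>
  define k where "k = N - 1"
  have k: "k < N" "Suc k = N" using N_pos by (simp_all add: k_def)
  have "start (Suc (n - 1)) = N" using n_ge_2 by simp
  moreover have "start (n - 1) < N" using start_less[of "n - 1"] n_ge_2 by simp
  ultimately have "column k = n - 1" using k by (intro column_eqI) simp_all
  moreover have "p = n" "start (Suc n) = N" using False assms start_beyond[of "Suc n"] by simp_all
  ultimately show ?thesis using k n_ge_2 unfolding labels_strand_crossings
    by (auto intro!: bexI[of _ k] simp: strand_def)
qed

text \<open>All joins become loops at labels of crossings, so they disappear.\<close>
lemma bracket_diagram_strands: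
  "bracket diagram = bracket (PD (map strand_crossing [0..<N]) [])"
proof -
  have "map (map_crossing strand) (crossings diagram) = map strand_crossing [0..<N]"
    by (simp add: crossings_diagram strand_crossing_def twist_crossing_def)
  then have "bracket diagram =
      bracket (PD (map strand_crossing [0..<N]) (map (map_prod strand strand) (joins diagram)))"
    using bracket_collapse[of points strand "joins diagram" "crossings diagram"]
      connected_iff_strand labels_diagram Field_diagram by simp
  also have "\<dots> = bracket (PD (map strand_crossing [0..<N]) [])"
  proof -
    have loop: "x = y \<and> x \<in> labels (map strand_crossing [0..<N])"
      if xy: "(x, y) \<in> set (map (map_prod strand strand) (joins diagram))" for x y
    proof -
      from xy obtain a b where ab: "(a, b) \<in> set (joins diagram)" "x = strand a" "y = strand b" by auto
      then have "a \<in> points" using Field_diagram by (auto simp: Field_def)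
      then show ?thesis using ab strand_join[OF ab(1)] strand_top_in_labels
        by (auto simp: points_def)
    qed
    show ?thesis
    proof (rule bracket_cong_connected)
      show "connected_by (map (map_prod strand strand) (joins diagram)) = connected_by []"
        by (rule connected_by_eqI) (use loop in fastforce)+
      show "Field (set (map (map_prod strand strand) (joins diagram))) \<union> labels (map strand_crossing [0..<N]) =
          Field (set []) \<union> labels (map strand_crossing [0..<N])"
        using loop unfolding Field_def by fastforce
    qed
  qed
  finally show ?thesis .
qed

definition column_bracket :: "nat \<Rightarrow> laurent" where
  "column_bracket m = A_pow (twist_sign pos) ^ m * loop_value + twist_coeff (twist_sign pos) m"

text \<open>Column by column from the left. The columns before \<open>i\<close> are replaced by a single strand that joins the
two ends at position \<open>i\<close> of column \<open>i\<close>. Expanding column \<open>i\<close>, the vertical smoothing closes this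
strand up to a circle and leaves a strand at position \<open>i + 1\<close>; the horizontal smoothing merges
everything into that strand.\<close>
lemma bracket_columns:
  assumes "1 \<le> i" "i \<le> n"
  shows "bracket (PD (map strand_crossing [start i..<N]) [(strand (start i, i), (0, i))]) =
    (\<Prod>j=i..<n. column_bracket (M j))"
  using assms(2,1)
proof (induction i rule: inc_induct)
  case base
  have "strand (N, n) = (0, n)"
    using start_beyond[of "Suc n"] by (simp add: strand_def)
  then show ?case by (simp add: bracket_unknot del: bracket.simps)
next
  case (step i)
  let ?m = "M i" and ?e = "twist_sign pos"
  let ?x = "\<lambda>t. strand (start i + t, i)" and ?y = "\<lambda>t. strand (start i + t, Suc i)"
  let ?Xs = "map strand_crossing [start (Suc i)..<N]"
  let ?a = "strand (start i, i)" and ?b = "strand (start (Suc i), Suc i)"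
  have m: "?m > 0" using M_pos step by simp
  have column: "column (start i + t) = i" if "t < ?m" for t
    by (rule column_eqI) (use that in \<open>simp_all add: start_Suc\<close>)
  \<comment> \<open>Later columns do not involve position \<open>i\<close>, so the strand at position \<open>i\<close> is not used again.\<close>
  have pos_ge: "snd z \<ge> Suc i" if z: "z \<in> labels ?Xs" for z
  proof -
    from z obtain k where k: "start (Suc i) \<le> k" "k < N" and zk: "snd z \<ge> column k"
      by (auto simp: labels_strand_crossings strand_def)
    with column_ge[OF k(2,1)] show ?thesis by simp
  qed
  have ends: "?x 0 = ?a" "?x ?m = (0, i)" "?y 0 = (0, Suc i)" "?y ?m = ?b"
    using start_mono[of i "Suc i"] start_mono[of "Suc i" "Suc (Suc i)"]
    by (auto simp: start_Suc[symmetric] strand_def)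
  have inner: "?x t = (start i + t, i)" "?y t = (start i + t, Suc i)" if "0 < t" "t < ?m" for t
    using that start_mono[of "i - 1" i] start_mono[of "Suc i" "Suc (Suc i)"]
    by (auto simp: strand_def start_Suc)
  have split: "map strand_crossing [start i..<N] = twist_region pos ?x ?y ?m @ ?Xs"
  proof -
    have "map strand_crossing [start i..<start (Suc i)] = twist_region pos ?x ?y ?m"
      by (rule nth_equalityI)
        (simp_all add: start_Suc twist_region_def strand_crossing_def column)
    moreover have "[start i..<N] = [start i..<start (Suc i)] @ [start (Suc i)..<N]"
      using upt_add_eq_append[of "start i" "start (Suc i)" "N - start (Suc i)"]
        start_mono[of i "Suc i"] start_le_N[of "Suc i"] by simp
    ultimately show ?thesis by simp
  qed
  have ab: "snd ?a = i" "snd ?b = Suc i" by (simp_all add: strand_def)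
  have ne: "?a \<noteq> ?b" "(0, i) \<noteq> ?b" "?a \<noteq> (0, Suc i)"
    using ab by (metis n_not_Suc_n snd_conv)+
  have not_in: "?a \<notin> labels ?Xs" "(0, i) \<notin> labels ?Xs"
    using pos_ge[of ?a] pos_ge[of "(0, i)"] ab by auto
  let ?S = "[(?a, (0, i))]"
  have "bracket (PD (map strand_crossing [start i..<N]) ?S) =
      A_pow ?e ^ ?m * bracket (PD ?Xs ((?a, (0, i)) # ((0, Suc i), ?b) # ?S)) +
      twist_coeff ?e ?m * bracket (PD ?Xs ((?a, (0, Suc i)) # ((0, i), ?b) # ?S))"
    unfolding split ends[symmetric]
  proof (rule bracket_twist_region[OF m], goal_cases)
    case (1 t)
    have "?x t \<notin> labels ?Xs" using pos_ge[of "?x t"] by (auto simp: strand_def)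
    moreover have "?y t \<notin> labels ?Xs"
    proof
      assume "?y t \<in> labels ?Xs"
      then obtain k where k: "start (Suc i) \<le> k" and
        "?y t = strand (k, column k) \<or> ?y t = strand (Suc k, column k) \<or>
         ?y t = strand (Suc k, Suc (column k)) \<or> ?y t = strand (k, Suc (column k))"
        by (auto simp: labels_strand_crossings)
      then have "fst (?y t) = 0 \<or> fst (?y t) = k \<or> fst (?y t) = Suc k"
        by (auto simp: strand_def)
      with k 1 show False by (simp add: inner start_Suc)
    qed
    moreover have "?x t \<noteq> ?a" "?x t \<noteq> (0, i)" "?y t \<noteq> ?a" "?y t \<noteq> (0, i)"
      using 1 inner[OF 1] by (auto simp: strand_def split: if_splits)
    ultimately show ?case unfolding ends by simp
  next
    case (2 t u)
    then show ?case by (simp add: strand_def)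
  next
    case (3 t u)
    then show ?case unfolding inner[OF 3(1,2)] by (auto simp: strand_def)
  qed
  also have "bracket (PD ?Xs ((?a, (0, i)) # ((0, Suc i), ?b) # ?S)) =
      loop_value * bracket (PD ?Xs [(?b, (0, Suc i))])"
  proof -
    have "bracket (PD ?Xs ((?a, (0, i)) # ((0, Suc i), ?b) # ?S)) =
        bracket (PD ?Xs ((?a, (0, i)) # [(?b, (0, Suc i))]))"
      by (rule bracket_joins_cong) auto
    also have "\<dots> = loop_value * bracket (PD ?Xs [(?b, (0, Suc i))])"
      by (rule bracket_split_circle) (use not_in ne in \<open>auto simp: Field_def\<close>)
    finally show ?thesis .
  qed
  also have "bracket (PD ?Xs ((?a, (0, Suc i)) # ((0, i), ?b) # ?S)) =
      bracket (PD ?Xs [(?b, (0, Suc i))])"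
  proof -
    let ?S' = "(?a, (0, Suc i)) # ((0, i), ?b) # ?S"
    let ?f = "\<lambda>z. if z = ?a \<or> z = (0, i) then (0, Suc i) else z"
    have c: "(z, ?f z) \<in> connected_by ?S'" for z
      using connected_by_join[of ?a "(0, Suc i)" ?S'] connected_by_join_rev[of ?a "(0, i)" ?S']
      by (auto intro: connected_by_trans)
    have "bracket (PD ?Xs ?S') =
        bracket (PD (map (map_crossing ?f) ?Xs) (map (map_prod ?f ?f) ?S'))"
    proof (rule bracket_collapse[where K = UNIV])
      fix u v assume eq: "?f u = ?f v"
      have "(u, ?f v) \<in> connected_by ?S'" using c[of u] unfolding eq .
      then show "(u, v) \<in> connected_by ?S'" by (rule connected_by_trans) (rule connected_by_sym[OF c])
    qed simp
    also have "map (map_crossing ?f) ?Xs = ?Xs"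
      by (rule map_crossing_fresh) (use not_in in auto)
    also have "map (map_prod ?f ?f) ?S' =
        [((0, Suc i), (0, Suc i)), ((0, Suc i), ?b), ((0, Suc i), (0, Suc i))]"
      using ne by auto
    also have "bracket (PD ?Xs \<dots>) = bracket (PD ?Xs [(?b, (0, Suc i))])"
      by (rule bracket_cong_connected, rule connected_by_eqI)
        (auto intro: connected_by_join connected_by_join_rev)
    finally show ?thesis .
  qed
  finally have "bracket (PD (map strand_crossing [start i..<N]) ?S) =
      column_bracket ?m * bracket (PD ?Xs [(?b, (0, Suc i))])"
    by (simp add: column_bracket_def algebra_simps)
  then show ?case
    using step by (simp add: prod.atLeast_Suc_lessThan)
qed

lemma bracket_diagram: "bracket diagram = (\<Prod>i=1..<n. column_bracket (M i))"
proof -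
  have "bracket (PD (map strand_crossing [0..<N]) []) =
      bracket (PD (map strand_crossing [0..<N]) [((0, 1), (0, 1))])"
    by (rule bracket_cong_connected, rule connected_by_eqI)
      (use strand_top_in_labels[of 1] n_ge_2 in auto)
  then show ?thesis
    using bracket_columns[of 1] n_ge_2 by (simp add: bracket_diagram_strands strand_def)
qed

section \<open>Faces of the closed braid\<close>

text \<open>The corner of crossing \<open>k\<close> in direction \<open>d\<close>, where \<open>0, 1, 2, 3\<close> stand for left, bottom, right
and top. The numbering of corners starts at the under-strand, hence the shift for negative
crossings.\<close>
definition corner_at :: "nat \<Rightarrow> nat \<Rightarrow> nat \<times> nat" where
  "corner_at k d = (k, (if pos then d else Suc d) mod 4)"

text \<open>The label of the end of crossing \<open>k\<close> that precedes corner \<open>d\<close> counterclockwise: top left, bottom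
left, bottom right and top right for \<open>d = 0, 1, 2, 3\<close>.\<close>
definition end_point :: "nat \<Rightarrow> nat \<Rightarrow> nat \<times> nat" where
  "end_point k d = (if d \<in> {1, 2} then Suc k else k, if d \<in> {2, 3} then Suc (column k) else column k)"

lemma less_4_cases: "d < 4 \<Longrightarrow> d = 0 \<or> d = 1 \<or> d = 2 \<or> d = (3 :: nat)"
  by linarith

lemma corner_at_inject:
  assumes "d < 4" "e < 4"
  shows "corner_at k d = corner_at k' e \<longleftrightarrow> k = k' \<and> d = e"
  using less_4_cases[OF assms(1)] less_4_cases[OF assms(2)]
  by (elim disjE) (simp_all add: corner_at_def)

lemma corner_at_plus:
  "d < 4 \<Longrightarrow> (k, (snd (corner_at k d) + j) mod 4) = corner_at k ((d + j) mod 4)"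
  using mod_add_left_eq[of "Suc d" 4 j] mod_Suc_eq[of "d + j" 4]
  unfolding corner_at_def by (cases pos) simp_all

lemma length_crossings [simp]: "length (crossings diagram) = N"
  by (simp add: crossings_diagram)

lemma corners_diagram: "corners diagram = {corner_at k d | k d. k < N \<and> d < 4}"
proof (intro equalityI subsetI)
  fix c assume "c \<in> corners diagram"
  then obtain k j where kj: "c = (k, j)" "k < N" "j < 4" by (auto simp: corners_def)
  define d where "d = (if pos then j else j + 3) mod 4"
  have "d < 4" "c = corner_at k d"
    using kj by (auto simp: corner_at_def d_def dest!: less_4_cases)
  with kj show "c \<in> {corner_at k d | k d. k < N \<and> d < 4}" by blast
qed (auto simp: corners_def corner_at_def)

lemma corner_at_in_corners [simp]: "k < N \<Longrightarrow> d < 4 \<Longrightarrow> corner_at k d \<in> corners diagram"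
  by (auto simp: corners_diagram)

lemma fst_corner_at [simp]: "fst (corner_at k d) = k"
  by (simp add: corner_at_def)

lemma end_label_corner_at:
  assumes "k < N" "d < 4"
  shows "end_label (crossings diagram ! k) (snd (corner_at k d)) = end_point k d"
  using less_4_cases[OF assms(2)] assms(1)
  by (elim disjE) (simp_all add: crossings_diagram twist_crossing_def corner_at_def end_point_def)

lemma end_point_in_points:
  assumes "k < N" shows "end_point k d \<in> points"
  using column_spec(2,3)[OF assms] assms by (auto simp: end_point_def points_def)

lemma same_strand_iff:
  assumes "k < N" "k' < N" "d < 4" "e < 4"
  shows "same_strand diagram (corner_at k d) (corner_at k' e) \<longleftrightarrow>
    (k, d) \<noteq> (k', e) \<and> strand (end_point k d) = strand (end_point k' e)"
  using assms
  by (simp add: same_strand_def end_label_corner_at connected_iff_strand end_point_in_points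
      corner_at_inject)

text \<open>Names for the faces. A height strictly inside column \<open>i\<close> lies in a bigon, which is named after it;
all other heights of column \<open>i\<close> lie in the big face, which is named \<open>(0, i)\<close>. Columns \<open>0\<close> and
\<open>n\<close> contain no crossings, so that the formula yields only a big face for them.\<close>
definition region :: "nat \<Rightarrow> nat \<Rightarrow> nat \<times> nat" where
  "region h i = (if start i < h \<and> h < start (Suc i) then h else 0, i)"

definition corner_region :: "nat \<Rightarrow> nat \<Rightarrow> nat \<times> nat" where
  "corner_region k d =
     (if d = 0 then (0, column k - 1) else if d = 1 then region (Suc k) (column k)
      else if d = 2 then (0, Suc (column k)) else region k (column k))"

definition left_region :: "nat \<times> nat \<Rightarrow> nat \<times> nat" where
  "left_region = (\<lambda>(h, p). region h (p - 1))"

definition right_region :: "nat \<times> nat \<Rightarrow> nat \<times> nat" where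
  "right_region = (\<lambda>(h, p). region h p)"

text \<open>If a strand has points at several heights, then these heights lie outside both adjacent columns, and
so have the big face on either side.\<close>
lemma side_regions_strand:
  assumes "strand x = strand y"
  shows "left_region x = left_region y" "right_region x = right_region y"
proof -
  obtain h p h' p' where xy: "x = (h, p)" "y = (h', p')" by (cases x, cases y)
  have p: "p' = p" using assms by (simp add: xy strand_def split: if_splits)
  show "left_region x = left_region y" "right_region x = right_region y"
    using assms start_mono[of "p - 1" p] start_mono[of p "Suc p"]
    unfolding xy p
    by (cases p; auto simp: strand_def left_region_def right_region_def region_def split: if_splits)+
qed

text \<open>A strand leaves some crossing downwards and arrives at the next one from above. Hence two different
ends on the same strand are never both top ends or both bottom ends.\<close>
lemma ends_opposite:
  assumes "k < N" "k' < N" "d < 4" "e < 4" "(k, d) \<noteq> (k', e)"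
    and eq: "strand (end_point k d) = strand (end_point k' e)"
  shows "d \<in> {0, 3} \<longleftrightarrow> e \<notin> {0, 3}"
proof (rule ccontr)
  assume same: "\<not> ?thesis"
  define p where "p = snd (end_point k d)"
  have p: "snd (end_point k' e) = p"
    using eq unfolding p_def
    by (metis (no_types, lifting) case_prod_beta snd_conv strand_def)
  have range: "start (p - 1) \<le> j \<and> j < start (Suc p)" if "j < N" "snd (end_point j c) = p" for j c
    using that column_spec(2,4,5)[OF that(1)] start_mono[of "column j - 1" "column j"]
      start_mono[of "Suc (column j)" "Suc (Suc (column j))"]
    by (auto simp: end_point_def split: if_splits)
  define s :: nat where "s = (if d \<in> {1, 2} then 1 else 0)"
  have "e \<in> {1, 2} \<longleftrightarrow> d \<in> {1, 2}"
    using same less_4_cases[OF assms(3)] less_4_cases[OF assms(4)] by auto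
  then have ends: "end_point k d = (k + s, p)" "end_point k' e = (k' + s, p)"
    using p by (auto simp: prod_eq_iff p_def s_def end_point_def)
  have k: "start (p - 1) \<le> k" "k < start (Suc p)" "start (p - 1) \<le> k'" "k' < start (Suc p)"
    using range[OF assms(1), of d] range[OF assms(2), of e] ends by simp_all
  have "s = 0 \<or> s = 1" by (simp add: s_def)
  then have "k = k'"
    using eq k unfolding ends strand_def prod.case prod.inject
    by (elim disjE) (simp_all split: if_splits)
  moreover have "d = e" if "k = k'"
    using p same less_4_cases[OF assms(3)] less_4_cases[OF assms(4)]
    unfolding p_def that by (elim disjE) (simp_all add: end_point_def)
  ultimately show False using assms(5) by blast
qed

lemma corner_region_leaving:
  assumes "k < N" "d < 4"
  shows "corner_region k d =
    (if Suc d mod 4 \<in> {0, 3} then right_region (end_point k (Suc d mod 4))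
     else left_region (end_point k (Suc d mod 4)))"
  using less_4_cases[OF assms(2)] column_spec(2,4,5)[OF assms(1)] start_mono[of "column k - 1" "column k"]
  by (elim disjE) (simp_all add: corner_region_def left_region_def right_region_def region_def end_point_def)

lemma corner_region_arriving:
  assumes "k < N" "d < 4"
  shows "corner_region k d =
    (if d \<in> {0, 3} then left_region (end_point k d) else right_region (end_point k d))"
  using less_4_cases[OF assms(2)] column_spec(2,4,5)[OF assms(1)] start_mono[of "column k - 1" "column k"]
  by (elim disjE) (simp_all add: corner_region_def left_region_def right_region_def region_def end_point_def)

lemma next_corner_iff:
  assumes "k < N" "k' < N" "d < 4" "e < 4"
  shows "(corner_at k d, corner_at k' e) \<in> next_corner diagram \<longleftrightarrow>
    (k, Suc d mod 4) \<noteq> (k', e) \<and> strand (end_point k (Suc d mod 4)) = strand (end_point k' e)"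
proof -
  have "(c, c') \<in> next_corner D \<longleftrightarrow>
      c \<in> corners D \<and> c' \<in> corners D \<and> same_strand D (fst c, (snd c + 1) mod 4) c'"
    for D :: "(nat \<times> nat) pd" and c c'
    by (cases c; cases c') (simp add: next_corner_def)
  then show ?thesis
    using assms same_strand_iff[of k k' "Suc d mod 4" e] corner_at_plus[of d k 1] by simp
qed

text \<open>Following a strand with the face on the right, one has the left region of the strand on
that side when moving down, and the right region when moving up; by \<open>ends_opposite\<close> the direction
is the same at both ends.\<close>
lemma next_corner_region:
  assumes "(corner_at k d, corner_at k' e) \<in> next_corner diagram" "k < N" "k' < N" "d < 4" "e < 4"
  shows "corner_region k d = corner_region k' e"
proof -
  have s: "(k, Suc d mod 4) \<noteq> (k', e)" "strand (end_point k (Suc d mod 4)) = strand (end_point k' e)"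
    using assms by (simp_all add: next_corner_iff)
  have "Suc d mod 4 \<in> {0, 3} \<longleftrightarrow> e \<notin> {0, 3}"
    by (rule ends_opposite[OF assms(2,3) _ assms(5) s]) simp
  then show ?thesis
    unfolding corner_region_leaving[OF assms(2,4)] corner_region_arriving[OF assms(3,5)]
    using side_regions_strand[OF s(2)] by (cases "e \<in> {0, 3}") (simp_all only: if_True if_False not_True_eq_False not_False_eq_True)
qed

definition same_face :: "nat \<times> nat \<Rightarrow> nat \<times> nat \<Rightarrow> bool" where
  "same_face c c' \<longleftrightarrow> (c, c') \<in> (next_corner diagram \<union> (next_corner diagram)\<inverse>)\<^sup>*"

lemma same_face_refl [simp]: "same_face c c"
  by (simp add: same_face_def)

lemma same_face_sym: "same_face c c' \<Longrightarrow> same_face c' c"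
  unfolding same_face_def by (meson sym_Un_converse sym_rtrancl symD)

lemma same_face_trans [trans]: "same_face c c' \<Longrightarrow> same_face c' c'' \<Longrightarrow> same_face c c''"
  unfolding same_face_def by (rule rtrancl_trans)

lemma same_face_strand:
  assumes "k < N" "k' < N" "d < 4" "e < 4"
    and "(k, Suc d mod 4) \<noteq> (k', e)" "strand (end_point k (Suc d mod 4)) = strand (end_point k' e)"
  shows "same_face (corner_at k d) (corner_at k' e)"
  using assms unfolding same_face_def by (intro r_into_rtrancl) (simp add: next_corner_iff)

lemma same_face_region:
  assumes "same_face (corner_at k d) c" "k < N" "d < 4"
  shows "\<exists>k' e. k' < N \<and> e < 4 \<and> c = corner_at k' e \<and> corner_region k d = corner_region k' e"
  using assms(1) unfolding same_face_def
proof (induction rule: rtrancl_induct)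
  case base
  then show ?case using assms by blast
next
  case (step c c')
  then obtain k' e where c: "k' < N" "e < 4" "c = corner_at k' e" "corner_region k d = corner_region k' e"
    by blast
  have "c' \<in> corners diagram"
    using step.hyps(2) by (auto simp: next_corner_def)
  then obtain k'' e' where c': "k'' < N" "e' < 4" "c' = corner_at k'' e'"
    by (auto simp: corners_diagram)
  have "corner_region k' e = corner_region k'' e'"
    using step.hyps(2) c(1-3) c' next_corner_region by (metis UnE converseD)
  then show ?case using c c' by auto
qed

lemma same_face_column:
  assumes "1 \<le> i" "start i \<le> k" "k \<le> k'" "k' < start (Suc i)"
  shows "same_face (corner_at k 0) (corner_at k' 0)" "same_face (corner_at k 2) (corner_at k' 2)"
proof -
  have "same_face (corner_at k 0) (corner_at k' 0) \<and> same_face (corner_at k 2) (corner_at k' 2)"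
    using assms(3,4)
  proof (induction k' rule: dec_induct)
    case (step j)
    have j: "column j = i" "column (Suc j) = i" "j < N" "Suc j < N"
      using step assms column_eqI[of i j] column_eqI[of i "Suc j"] start_le_N[of "Suc i"] by simp_all
    have "same_face (corner_at j 0) (corner_at (Suc j) 0)"
      by (rule same_face_strand) (use j in \<open>simp_all add: end_point_def\<close>)
    moreover have "same_face (corner_at (Suc j) 2) (corner_at j 2)"
      by (rule same_face_strand) (use j in \<open>simp_all add: end_point_def\<close>)
    ultimately show ?case using step same_face_trans same_face_sym by (meson Suc_lessD)
  qed simp
  then show "same_face (corner_at k 0) (corner_at k' 0)" "same_face (corner_at k 2) (corner_at k' 2)"
    by auto
qed

text \<open>A corner of each face that serves as a meeting point for walks along the boundary of the face: the top
corner of the crossing below a bigon, and the top corner of the first crossing of the column for a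
big face, with the obvious substitutes for the empty columns \<open>0\<close> and \<open>n\<close>.\<close>
definition region_corner :: "nat \<times> nat \<Rightarrow> nat \<times> nat" where
  "region_corner = (\<lambda>(h, i). if h > 0 then corner_at h 3 else if i = 0 then corner_at 0 0
     else if i < n then corner_at (start i) 3 else corner_at (N - 1) 2)"

lemma column_ends:
  assumes "1 \<le> i" "i < n"
  shows "start i < N" "column (start i) = i" "start (Suc i) - 1 < N"
    "column (start (Suc i) - 1) = i" "Suc (start (Suc i) - 1) = start (Suc i)"
    "start i \<le> start (Suc i) - 1"
  using start_less[OF assms] start_le_N[of "Suc i"] column_eqI[of i "start i"]
    column_eqI[of i "start (Suc i) - 1"] by auto

text \<open>The bottom corner of the last crossing of a column is the critical case: it is connected to the top
corner of the first crossing of the column by going around. The walk follows the left corners of the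
next column and then the closing arc at position \<open>i + 1\<close>; if there is no next column, then
the closing arc alone suffices.\<close>
lemma same_face_bottom:
  assumes "k < N"
  shows "same_face (corner_at k 1) (region_corner (region (Suc k) (column k)))"
proof -
  let ?i = "column k"
  note i = column_spec(2-5)[OF assms]
  show ?thesis
  proof (cases "Suc k < start (Suc ?i)")
    case True
    then have "Suc k < N" "column (Suc k) = ?i"
      using start_le_N[of "Suc ?i"] i by (auto intro: column_eqI)
    then have "same_face (corner_at k 1) (corner_at (Suc k) 3)"
      using assms by (intro same_face_strand) (simp_all add: end_point_def)
    then show ?thesis using True i by (simp add: region_corner_def region_def)
  next
    case False
    then have k: "Suc k = start (Suc ?i)" using i by simp
    note first = column_ends[OF i(1,2)]
    have "same_face (corner_at k 1) (corner_at (start ?i) 3)"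
    proof (cases "Suc ?i < n")
      case True
      note nxt = column_ends[of "Suc ?i", simplified, OF True]
      have "same_face (corner_at k 1) (corner_at (start (Suc ?i)) 0)"
        by (rule same_face_strand) (use assms nxt k in \<open>simp_all add: end_point_def\<close>)
      also have "same_face \<dots> (corner_at (start (Suc (Suc ?i)) - 1) 0)"
        by (rule same_face_column[of "Suc ?i"]) (use nxt start_less[of "Suc ?i"] True in simp_all)
      also have "same_face \<dots> (corner_at (start ?i) 3)"
        by (rule same_face_strand)
          (use first nxt start_mono[of ?i "Suc ?i"] in \<open>simp_all add: end_point_def strand_def\<close>)
      finally show ?thesis .
    next
      case False
      then have "Suc ?i = n" using i by simp
      then have "start (Suc (Suc ?i)) = start (Suc ?i)" using start_beyond[of "Suc n"] by simp
      then show ?thesis using assms first k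
        by (intro same_face_strand) (simp_all add: end_point_def strand_def)
    qed
    then show ?thesis using False i by (simp add: region_corner_def region_def)
  qed
qed

lemma same_face_left:
  assumes "k < N"
  shows "same_face (corner_at k 0) (region_corner (0, column k - 1))"
proof -
  let ?i = "column k"
  note i = column_spec(2-5)[OF assms]
  note ends = column_ends[OF i(1,2)]
  have first: "same_face (corner_at k 0) (corner_at (start ?i) 0)"
    using same_face_column(1)[of ?i "start ?i" k] i by (simp add: same_face_sym)
  show ?thesis
  proof (cases "?i = 1")
    case True
    then show ?thesis using first by (simp add: region_corner_def)
  next
    case False
    then have prev: "1 \<le> ?i - 1" "?i - 1 < n" "Suc (?i - 1) = ?i" using i by simp_all
    note pe = column_ends[OF prev(1,2), unfolded prev(3)]
    have "same_face (corner_at (start ?i - 1) 1) (corner_at (start ?i) 0)"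
      by (rule same_face_strand) (use ends pe prev in \<open>simp_all add: end_point_def\<close>)
    with first have "same_face (corner_at k 0) (corner_at (start ?i - 1) 1)"
      using same_face_sym same_face_trans by blast
    also have "same_face \<dots> (region_corner (region (start ?i) (?i - 1)))"
      using same_face_bottom[OF pe(3)] unfolding pe(4,5) .
    also have "region (start ?i) (?i - 1) = (0, ?i - 1)"
      using prev(3) by (simp add: region_def)
    finally show ?thesis .
  qed
qed

lemma same_face_right:
  assumes "k < N"
  shows "same_face (corner_at k 2) (region_corner (0, Suc (column k)))"
proof -
  let ?i = "column k"
  note i = column_spec(2-5)[OF assms]
  note ends = column_ends[OF i(1,2)]
  have last: "same_face (corner_at k 2) (corner_at (start (Suc ?i) - 1) 2)"
    by (rule same_face_column[of ?i]) (use i in simp_all)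
  show ?thesis
  proof (cases "Suc ?i < n")
    case True
    note nxt = column_ends[of "Suc ?i", simplified, OF True]
    have T: "same_face (corner_at (start (Suc ?i)) 3) (corner_at (start (Suc ?i) - 1) 2)"
      by (rule same_face_strand) (use ends nxt in \<open>simp_all add: end_point_def\<close>)
    show ?thesis
      using same_face_trans[OF last same_face_sym[OF T]] True by (simp add: region_corner_def)
  next
    case False
    then have "Suc ?i = n" using i by simp
    with last show ?thesis by (simp add: region_corner_def)
  qed
qed

lemma same_face_top:
  assumes "k < N"
  shows "same_face (corner_at k 3) (region_corner (region k (column k)))"
  using column_spec(2-5)[OF assms] by (auto simp: region_corner_def region_def)

lemma same_face_region_corner:
  assumes "k < N" "d < 4"
  shows "same_face (corner_at k d) (region_corner (corner_region k d))"
  using less_4_cases[OF assms(2)] same_face_bottom[OF assms(1)] same_face_left[OF assms(1)]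
    same_face_right[OF assms(1)] same_face_top[OF assms(1)]
  by (auto simp: corner_region_def)

definition face :: "nat \<times> nat \<Rightarrow> (nat \<times> nat) set" where
  "face x = {corner_at k d | k d. k < N \<and> d < 4 \<and> corner_region k d = x}"

text \<open>\<open>next_corner_region\<close> shows that a face stays within one region, and \<open>same_face_region_corner\<close>
that it fills the region.\<close>
lemma face_of_corner:
  assumes "k < N" "d < 4"
  shows "face_of diagram (corner_at k d) = face (corner_region k d)"
proof
  show "face_of diagram (corner_at k d) \<subseteq> face (corner_region k d)"
    using same_face_region[OF _ assms] by (fastforce simp: face_of_def same_face_def face_def)
  show "face (corner_region k d) \<subseteq> face_of diagram (corner_at k d)"
  proof
    fix c assume "c \<in> face (corner_region k d)"
    then obtain k' e where c: "c = corner_at k' e" "k' < N" "e < 4" "corner_region k' e = corner_region k d"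
      by (auto simp: face_def)
    have "same_face (corner_at k d) c"
      using same_face_region_corner[OF assms] same_face_region_corner[OF c(2,3)]
      unfolding c(1,4) by (meson same_face_sym same_face_trans)
    then show "c \<in> face_of diagram (corner_at k d)" by (simp add: face_of_def same_face_def)
  qed
qed

definition regions :: "(nat \<times> nat) set" where
  "regions = {corner_region k d | k d. k < N \<and> d < 4}"

lemma faces_diagram: "faces diagram = face ` regions"
proof -
  have "faces diagram = {face_of diagram (corner_at k d) | k d. k < N \<and> d < 4}"
    unfolding faces_def corners_diagram by blast
  also have "\<dots> = {face (corner_region k d) | k d. k < N \<and> d < 4}"
    by (rule Collect_cong) (metis face_of_corner)
  also have "\<dots> = face ` regions"
    unfolding regions_def by blast
  finally show ?thesis .
qed

lemma inj_on_face: "inj_on face regions"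
proof (rule inj_onI)
  fix x y assume "x \<in> regions" "y \<in> regions" and eq: "face x = face y"
  then obtain k d where "k < N" "d < 4" "x = corner_region k d" by (auto simp: regions_def)
  then have "corner_at k d \<in> face y" unfolding eq[symmetric] by (auto simp: face_def)
  then show "x = y"
    using \<open>k < N\<close> \<open>d < 4\<close> \<open>x = corner_region k d\<close> by (auto simp: face_def corner_at_inject)
qed

lemma touches_face:
  assumes "k < N" "x \<in> regions"
  shows "touches diagram k (face x) \<longleftrightarrow> (\<exists>d<4. corner_region k d = x)"
proof -
  have "touches diagram k (face x) \<longleftrightarrow> (\<exists>d<4. face_of diagram (corner_at k d) = face x)"
  proof -
    have "(\<exists>i<4. P (k, i)) \<longleftrightarrow> (\<exists>d<4. P (corner_at k d))" for P
    proof
      assume "\<exists>i<4. P (k, i)"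
      then obtain i where i: "i < 4" "P (k, i)" by blast
      then have "(k, i) \<in> corners diagram" using assms by (simp add: corners_def)
      then obtain k' d where d: "d < 4" "(k, i) = corner_at k' d"
        unfolding corners_diagram by blast
      then have "k' = k" by (simp add: corner_at_def)
      with i d show "\<exists>d<4. P (corner_at k d)" by auto
    next
      assume "\<exists>d<4. P (corner_at k d)"
      then obtain d where "d < 4" "P (corner_at k d)" by blast
      then show "\<exists>i<4. P (k, i)"
        by (intro exI[of _ "snd (corner_at k d)"]) (simp add: corner_at_def)
    qed
    from this[of "\<lambda>c. face_of diagram c = face x"] show ?thesis by (simp add: touches_def)
  qed
  also have "\<dots> \<longleftrightarrow> (\<exists>d<4. corner_region k d = x)"
  proof -
    have "face_of diagram (corner_at k d) = face x \<longleftrightarrow> corner_region k d = x" if "d < 4" for d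
    proof -
      have "corner_region k d \<in> regions" using that assms(1) unfolding regions_def by blast
      then show ?thesis
        unfolding face_of_corner[OF assms(1) that] using inj_on_eq_iff[OF inj_on_face] assms(2) by simp
    qed
    then show ?thesis by blast
  qed
  finally show ?thesis .
qed

section \<open>Coloring, weights and perfect matchings\<close>

lemma corner_regionI:
  assumes "k < N"
  shows "(0, column k - 1) \<in> regions" "(0, Suc (column k)) \<in> regions"
    "region k (column k) \<in> regions" "region (Suc k) (column k) \<in> regions"
proof -
  have "corner_region k d \<in> regions" if "d < 4" for d
    using assms that unfolding regions_def by blast
  from this[of 0] this[of 2] this[of 3] this[of 1]
  show "(0, column k - 1) \<in> regions" "(0, Suc (column k)) \<in> regions"
    "region k (column k) \<in> regions" "region (Suc k) (column k) \<in> regions"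
    by (simp_all add: corner_region_def)
qed

definition shaded :: "(nat \<times> nat) set set" where
  "shaded = face ` {x \<in> regions. odd (snd x)}"

lemma face_in_shaded: "x \<in> regions \<Longrightarrow> face x \<in> shaded \<longleftrightarrow> odd (snd x)"
  using inj_on_image_mem_iff[OF inj_on_face, of x "{x \<in> regions. odd (snd x)}"]
  by (auto simp: shaded_def)

lemma face_of_in_shaded:
  assumes "k < N" "d < 4"
  shows "face_of diagram (corner_at k d) \<in> shaded \<longleftrightarrow> (odd (column k) \<longleftrightarrow> odd d)"
proof -
  have "corner_region k d \<in> regions" using assms unfolding regions_def by blast
  then have "face_of diagram (corner_at k d) \<in> shaded \<longleftrightarrow> odd (snd (corner_region k d))"
    using assms by (simp add: face_of_corner face_in_shaded)
  also have "\<dots> \<longleftrightarrow> (odd (column k) \<longleftrightarrow> odd d)"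
    using less_4_cases[OF assms(2)] column_spec(2)[OF assms(1)]
    by (elim disjE) (simp_all add: corner_region_def region_def)
  finally show ?thesis .
qed

lemma column_0: "column 0 = 1"
  using start_less[of 1] n_ge_2 by (intro column_eqI) simp_all

lemma outer_corner: "closure_outer_corner word = corner_at 0 0"
proof -
  have "(LEAST k. k < length word \<and> fst (word ! k) = 1) = 0"
    using N_pos column_0 by (intro Least_eq_0) (simp add: column_def)
  then show ?thesis
    using column_spec(1)[OF N_pos] by (simp add: closure_outer_corner_def corner_at_def)
qed

lemma checkerboard_shaded: "checkerboard diagram (closure_outer_corner word) shaded"
proof -
  have "face_of diagram c \<in> shaded \<longleftrightarrow> face_of diagram (fst c, (snd c + 3) mod 4) \<notin> shaded"
    if c: "c \<in> corners diagram" for c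
  proof -
    from c obtain k d where kd: "c = corner_at k d" "k < N" "d < 4"
      by (auto simp: corners_diagram)
    have "face_of diagram (k, (snd (corner_at k d) + 3) mod 4) \<in> shaded \<longleftrightarrow>
        (odd (column k) \<longleftrightarrow> odd ((d + 3) mod 4))"
      unfolding corner_at_plus[OF kd(3)] using kd by (intro face_of_in_shaded) simp_all
    moreover have "odd ((d + 3) mod 4) \<longleftrightarrow> even d"
      using less_4_cases[OF kd(3)] by auto
    ultimately show ?thesis using kd by (simp add: face_of_in_shaded)
  qed
  then have "\<forall>(k, i)\<in>corners diagram.
      face_of diagram (k, i) \<in> shaded \<longleftrightarrow> face_of diagram (k, (i + 3) mod 4) \<notin> shaded"
    by fastforce
  moreover have "face_of diagram (corner_at 0 0) \<notin> shaded"
    using N_pos column_0 by (simp add: face_of_in_shaded)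
  moreover have "shaded \<subseteq> faces diagram"
    by (auto simp: shaded_def faces_diagram)
  ultimately show ?thesis by (simp add: checkerboard_def outer_corner)
qed

text \<open>The A-smoothing of a positive letter joins the top and the bottom corner, which lie in column \<open>i\<close>;
that of a negative letter joins the left and the right one, which lie in columns of the other
parity.\<close>
lemma positive_crossing_iff:
  assumes "k < N"
  shows "positive_crossing diagram shaded k \<longleftrightarrow> (odd (column k) \<longleftrightarrow> pos)"
proof -
  have c: "face_of diagram (corner_at k d) \<in> shaded \<longleftrightarrow> (odd (column k) \<longleftrightarrow> odd d)" if "d < 4" for d
    using face_of_in_shaded[OF assms that] .
  show ?thesis
  proof (cases pos)
    case True
    then have "(k, 1) = corner_at k 1" "(k, 3) = corner_at k 3"
      unfolding corner_at_def by simp_all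
    moreover have "odd (1 :: nat)" "odd (3 :: nat)" by simp_all
    ultimately show ?thesis
      using c[of 1] c[of 3] True unfolding positive_crossing_def by fastforce
  next
    case False
    then have "(k, 1) = corner_at k 0" "(k, 3) = corner_at k 2"
      unfolding corner_at_def by simp_all
    moreover have "even (0 :: nat)" "even (2 :: nat)" by simp_all
    ultimately show ?thesis
      using c[of 0] c[of 2] False unfolding positive_crossing_def by fastforce
  qed
qed

definition crossing_order :: "nat rel" where
  "crossing_order = {(a, b). a \<le> b \<and> b < N}"

lemma linear_order_crossing_order: "linear_order_on {..<N} crossing_order"
  by (auto simp: linear_order_on_def partial_order_on_def preorder_on_def refl_on_def trans_def
      antisym_def total_on_def crossing_order_def)

text \<open>Apart from activity, only the parity of the column of the face relative to that of the crossing matters: changing both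
parities exchanges capital with small letters as well as barred with unbarred ones.\<close>
lemma edge_weight_face:
  assumes "k < N" "x \<in> regions"
  shows "edge_weight diagram shaded crossing_order (k, face x) =
    (if even (snd x) \<longleftrightarrow> even (column k)
     then if lowest diagram crossing_order (k, face x)
          then - A_pow (-3 * twist_sign pos) else A_pow (twist_sign pos)
     else if lowest diagram crossing_order (k, face x)
          then - A_pow (3 * twist_sign pos) else A_pow (- twist_sign pos))"
  using assms
  by (simp add: edge_weight_def edge_letter_def positive_crossing_iff face_in_shaded twist_sign_def)

lemma touches_inner:
  assumes "u < N" "0 < h" "(h, i) \<in> regions"
  shows "touches diagram u (face (h, i)) \<longleftrightarrow>
    column u = i \<and> start i < h \<and> h < start (Suc i) \<and> (h = u \<or> h = Suc u)"
proof -
  have "(\<exists>d<4. corner_region u d = (h, i)) \<longleftrightarrow>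
      region (Suc u) (column u) = (h, i) \<or> region u (column u) = (h, i)"
    using assms(2)
    by (auto simp: corner_region_def split: if_splits intro: exI[of _ 1] exI[of _ 3])
  then show ?thesis
    using assms by (auto simp: touches_face region_def)
qed

lemma edge_weight_inner_below:
  assumes "k < N" "Suc k < start (Suc (column k))"
  shows "edge_weight diagram shaded crossing_order (k, face (Suc k, column k)) = - A_pow (-3 * twist_sign pos)"
proof -
  have r: "(Suc k, column k) \<in> regions"
    using corner_regionI(4)[OF assms(1)] assms(2) column_spec(4)[OF assms(1)] by (simp add: region_def)
  have "lowest diagram crossing_order (k, face (Suc k, column k))"
    using assms column_spec(4)[OF assms(1)] r by (auto simp: lowest_def touches_inner crossing_order_def)
  then show ?thesis using edge_weight_face[OF assms(1) r] by simp
qed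

lemma edge_weight_inner_above:
  assumes "k < N" "start (column k) < k"
  shows "edge_weight diagram shaded crossing_order (k, face (k, column k)) = A_pow (twist_sign pos)"
proof -
  note k = column_spec[OF assms(1)]
  have r: "(k, column k) \<in> regions"
    using corner_regionI(3)[OF assms(1)] assms(2) k by (simp add: region_def)
  have "column (k - 1) = column k"
    using assms k by (intro column_eqI) simp_all
  then have "touches diagram (k - 1) (face (k, column k))"
    using assms k r by (subst touches_inner) simp_all
  then have "\<not> lowest diagram crossing_order (k, face (k, column k))"
    using assms by (auto simp: lowest_def crossing_order_def intro!: exI[of _ "k - 1"])
  then show ?thesis using edge_weight_face[OF assms(1) r] by simp
qed

lemma edge_weight_outer:
  assumes "k < N"
  shows "edge_weight diagram shaded crossing_order (k, face (0, Suc (column k))) =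
    (if k = start (column k) then - A_pow (3 * twist_sign pos) else A_pow (- twist_sign pos))"
proof -
  let ?i = "column k"
  note k = column_spec[OF assms]
  note r = corner_regionI(2)[OF assms]
  have t: "touches diagram u (face (0, Suc ?i))" if "u < N" "column u = ?i" for u
    using that r by (auto simp: touches_face corner_region_def intro: exI[of _ 2])
  have ge: "start ?i \<le> u" if "touches diagram u (face (0, Suc ?i))" "u < N" for u
  proof -
    from that r obtain d where "d < 4" "corner_region u d = (0, Suc ?i)"
      by (auto simp: touches_face)
    then have "?i \<le> column u"
      by (auto simp: corner_region_def region_def split: if_splits)
    then show ?thesis using column_spec(4)[OF that(2)] start_mono[of ?i "column u"] by simp
  qed
  have "lowest diagram crossing_order (k, face (0, Suc ?i)) \<longleftrightarrow> k = start ?i"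
  proof
    assume "lowest diagram crossing_order (k, face (0, Suc ?i))"
    moreover have "start ?i < N" "touches diagram (start ?i) (face (0, Suc ?i))"
      using column_ends(1,2)[OF k(2,3)] t by simp_all
    ultimately show "k = start ?i"
      using k by (auto simp: lowest_def crossing_order_def)
  next
    assume "k = start ?i"
    then show "lowest diagram crossing_order (k, face (0, Suc ?i))"
      using assms t[OF assms] ge unfolding lowest_def crossing_order_def by auto
  qed
  then show ?thesis using edge_weight_face[OF assms r] by simp
qed

definition matched_regions :: "(nat \<times> nat) set" where
  "matched_regions = regions - {(0, 1), (0, 0)}"

lemma zero_regions: "(0, 0) \<in> regions" "(0, 1) \<in> regions"
  using corner_regionI(1,3)[OF N_pos] column_0 by (simp_all add: region_def)

lemma matched_faces: "faces diagram - {face (0, 1), face (0, 0)} = face ` matched_regions"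
  using inj_on_image_set_diff[OF inj_on_face, of regions "{(0, 1), (0, 0)}"] zero_regions
  by (simp add: faces_diagram matched_regions_def)

lemma matched_regions_cases:
  assumes "(h, i) \<in> matched_regions"
  shows "h = 0 \<and> 2 \<le> i \<and> i \<le> n \<or> 1 \<le> i \<and> i < n \<and> start i < h \<and> h < start (Suc i)"
proof -
  obtain k d where kd: "k < N" "d < 4" "(h, i) = corner_region k d" and ne: "(h, i) \<noteq> (0, 1)" "(h, i) \<noteq> (0, 0)"
    using assms unfolding matched_regions_def regions_def by blast
  note k = column_spec[OF kd(1)]
  show ?thesis
    using less_4_cases[OF kd(2)] kd(3) ne k(2,3)
    by (elim disjE) (auto simp: corner_region_def region_def split: if_splits)
qed

definition choices :: "(nat \<Rightarrow> nat) set" where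
  "choices = (\<Pi>\<^sub>E i\<in>{1..<n}. {start i..<start (Suc i)})"

text \<open>The region with which crossing \<open>k\<close> is matched if \<open>J i\<close> is the crossing of column \<open>i\<close> that takes
the big face \<open>i + 1\<close>.\<close>
definition matched :: "(nat \<Rightarrow> nat) \<Rightarrow> nat \<Rightarrow> nat \<times> nat" where
  "matched J k = (if k < J (column k) then (Suc k, column k)
     else if k = J (column k) then (0, Suc (column k)) else (k, column k))"

definition matching :: "(nat \<Rightarrow> nat) \<Rightarrow> edge set" where
  "matching J = (\<lambda>k. (k, face (matched J k))) ` {..<N}"

lemma choiceD:
  assumes "J \<in> choices" "1 \<le> i" "i < n"
  shows "start i \<le> J i" "J i < start (Suc i)" "column (J i) = i" "J i < N"
proof -
  show J: "start i \<le> J i" "J i < start (Suc i)"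
    using assms by (auto simp: choices_def dest: PiE_mem[where x = i])
  then show "column (J i) = i" "J i < N"
    using column_eqI start_le_N[of "Suc i"] by auto
qed

lemma matched_in_regions:
  assumes "J \<in> choices" "k < N"
  shows "matched J k \<in> matched_regions" "\<exists>d<4. corner_region k d = matched J k"
proof -
  note k = column_spec[OF assms(2)]
  note J = choiceD[OF assms(1) k(2,3)]
  show d: "\<exists>d<4. corner_region k d = matched J k"
    using J k
    by (auto simp: matched_def corner_region_def region_def intro: exI[of _ 1] exI[of _ 2] exI[of _ 3])
  then have "matched J k \<in> regions" using assms(2) unfolding regions_def by force
  then show "matched J k \<in> matched_regions"
    using k J by (auto simp: matched_regions_def matched_def)
qed

lemma inj_on_matched:
  assumes "J \<in> choices"
  shows "inj_on (matched J) {..<N}"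
proof (rule inj_onI)
  fix k k' assume kk: "k \<in> {..<N}" "k' \<in> {..<N}" and eq: "matched J k = matched J k'"
  then have k: "k < N" "k' < N" by simp_all
  have "start (column j) \<le> J (column j)" if "j < N" for j
    using choiceD(1)[OF assms] column_spec(2,3)[OF that] by simp
  then show "k = k'" using eq k
    by (auto simp: matched_def split: if_splits)
qed

lemma matched_regions_image:
  assumes "J \<in> choices"
  shows "matched_regions \<subseteq> matched J ` {..<N}"
proof
  fix x assume x: "x \<in> matched_regions"
  obtain h i where hi: "x = (h, i)" by (cases x)
  from matched_regions_cases[OF x[unfolded hi]] show "x \<in> matched J ` {..<N}"
  proof (elim disjE conjE)
    assume h: "h = 0" "2 \<le> i" "i \<le> n"
    then have i: "1 \<le> i - 1" "i - 1 < n" "Suc (i - 1) = i" by simp_all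
    note J = choiceD[OF assms i(1,2)]
    have "matched J (J (i - 1)) = x" using J(3) i(3) h(1) by (simp add: matched_def hi)
    with J(4) show ?thesis by (metis imageI lessThan_iff)
  next
    assume h: "1 \<le> i" "i < n" "start i < h" "h < start (Suc i)"
    have N: "h < N" using h(4) start_le_N[of "Suc i"] by simp
    show ?thesis
    proof (cases "h \<le> J i")
      case True
      have "column (h - 1) = i" using h by (intro column_eqI) simp_all
      moreover have "h - 1 < J i" using True h by linarith
      ultimately have "matched J (h - 1) = x" using h by (simp add: matched_def hi)
      moreover have "h - 1 < N" using N by simp
      ultimately show ?thesis by (metis imageI lessThan_iff)
    next
      case False
      have "column h = i" using h by (intro column_eqI) simp_all
      then have "matched J h = x" using False by (simp add: matched_def hi)
      with N show ?thesis by (metis imageI lessThan_iff)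
    qed
  qed
qed

abbreviation "is_matching \<equiv>
  perfect_matching {..<N} (face ` matched_regions) (tait_edges diagram (face ` matched_regions))"

lemma matching_perfect:
  assumes "J \<in> choices"
  shows "is_matching (matching J)"
  unfolding perfect_matching_def
proof (intro conjI ballI)
  show "matching J \<subseteq> tait_edges diagram (face ` matched_regions)"
  proof
    fix e assume "e \<in> matching J"
    then obtain k where k: "k < N" "e = (k, face (matched J k))" by (auto simp: matching_def)
    note r = matched_in_regions[OF assms k(1)]
    then have "touches diagram k (face (matched J k))"
      using k(1) by (subst touches_face) (auto simp: matched_regions_def)
    with k r(1) show "e \<in> tait_edges diagram (face ` matched_regions)"
      by (simp add: tait_edges_def)
  qed
  show "\<exists>!e. e \<in> matching J \<and> fst e = v" if "v \<in> {..<N}" for v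
    using that by (auto simp: matching_def)
  show "\<exists>!e. e \<in> matching J \<and> snd e = w" if w: "w \<in> face ` matched_regions" for w
  proof -
    from w obtain k where k: "k < N" "w = face (matched J k)"
      using matched_regions_image[OF assms] by auto
    have "j = k" if "j < N" "face (matched J j) = face (matched J k)" for j
    proof -
      have "matched J j = matched J k"
        using that(2) matched_in_regions(1)[OF assms that(1)] matched_in_regions(1)[OF assms k(1)]
          inj_on_eq_iff[OF inj_on_face] by (simp add: matched_regions_def)
      then show ?thesis using inj_on_eq_iff[OF inj_on_matched[OF assms]] that(1) k(1) by simp
    qed
    with k show ?thesis
      by (intro ex1I[of _ "(k, face (matched J k))"]) (auto simp: matching_def)
  qed
qed

lemma inj_on_matching: "inj_on matching choices"
proof (rule inj_onI)
  fix J J' assume J: "J \<in> choices" and J': "J' \<in> choices" and eq: "matching J = matching J'"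
  have same: "matched J k = matched J' k" if k: "k < N" for k
  proof -
    have "(k, face (matched J k)) \<in> matching J'" using k unfolding eq[symmetric] by (auto simp: matching_def)
    then have "face (matched J k) = face (matched J' k)" by (auto simp: matching_def)
    then show ?thesis
      using matched_in_regions(1)[OF J k] matched_in_regions(1)[OF J' k]
        inj_on_eq_iff[OF inj_on_face] by (simp add: matched_regions_def)
  qed
  show "J = J'"
  proof (rule PiE_ext)
    show "J \<in> (\<Pi>\<^sub>E i\<in>{1..<n}. {start i..<start (Suc i)})"
      "J' \<in> (\<Pi>\<^sub>E i\<in>{1..<n}. {start i..<start (Suc i)})"
      using J J' by (simp_all add: choices_def)
    fix i assume "i \<in> {1..<n}"
    then have i: "1 \<le> i" "i < n" by simp_all
    show "J i = J' i"
      using same[OF choiceD(4)[OF J i]] choiceD(1,3)[OF J i]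
      by (auto simp: matched_def split: if_splits)
  qed
qed

text \<open>The induction that yields \<open>pivot\<close> is the counting argument: the big faces \<open>i - 1\<close> and \<open>i\<close> are
omitted or already taken by earlier columns, and the bigons of column \<open>i\<close> are too few for all
its crossings. The facts \<open>below\<close> and \<open>above\<close> then propagate the forced edges from the two ends of
the column towards the chosen crossing.\<close>
lemma perfect_matching_choice:
  assumes "is_matching P"
  shows "\<exists>J\<in>choices. P = matching J"
proof -
  have sub: "P \<subseteq> tait_edges diagram (face ` matched_regions)"
    and ex1: "\<And>k. k < N \<Longrightarrow> \<exists>!e. e \<in> P \<and> fst e = k"
    and ex2: "\<And>w. w \<in> face ` matched_regions \<Longrightarrow> \<exists>!e. e \<in> P \<and> snd e = w"
    using assms by (auto simp: perfect_matching_def)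
  have "\<exists>x. x \<in> matched_regions \<and> (k, face x) \<in> P" if "k < N" for k
    using ex1[OF that] sub by (fastforce simp: tait_edges_def)
  then obtain f where f: "\<And>k. k < N \<Longrightarrow> f k \<in> matched_regions" "\<And>k. k < N \<Longrightarrow> (k, face (f k)) \<in> P"
    by metis
  have P: "P = (\<lambda>k. (k, face (f k))) ` {..<N}"
  proof
    show "P \<subseteq> (\<lambda>k. (k, face (f k))) ` {..<N}"
    proof
      fix e assume e: "e \<in> P"
      then have "fst e < N" using sub by (auto simp: tait_edges_def)
      with ex1[OF this] f(2)[OF this] e have "e = (fst e, face (f (fst e)))" by (metis fst_conv)
      with \<open>fst e < N\<close> show "e \<in> (\<lambda>k. (k, face (f k))) ` {..<N}" by blast
    qed
  qed (use f(2) in auto)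
  have inj: "k = k'" if "k < N" "k' < N" "f k = f k'" for k k'
    using ex2[of "face (f k)"] f that by (metis imageI prod.inject snd_conv)
  have near: "f k \<in> {(0, column k - 1), region (Suc k) (column k), (0, Suc (column k)), region k (column k)}"
    if k: "k < N" for k
  proof -
    have "touches diagram k (face (f k))"
      using sub f(2)[OF k] by (auto simp: tait_edges_def)
    moreover have "f k \<in> regions" using f(1)[OF k] by (simp add: matched_regions_def)
    ultimately obtain d where "corner_region k d = f k"
      using touches_face[OF k] by blast
    from this[symmetric] have "f k = corner_region k d" .
    then show ?thesis by (simp add: corner_region_def)
  qed
  have in_column: "k < N \<and> column k = i" if "start i \<le> k" "k < start (Suc i)" for i k
    using column_eqI[OF that] that start_le_N[of "Suc i"] by simp
  have pivot: "\<exists>j. start i \<le> j \<and> j < start (Suc i) \<and> f j = (0, Suc i)" if "1 \<le> i" "i < n" for i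
    using that
  proof (induction i rule: less_induct)
    case (less i)
    \<comment> \<open>Big faces up to \<open>i\<close> are omitted, or matched in an earlier column by induction hypothesis.\<close>
    have not_used: "f k \<noteq> (0, p)" if k: "start i \<le> k" "k < start (Suc i)" and p: "p \<le> i" for k p
    proof
      assume fk: "f k = (0, p)"
      have kN: "k < N" "column k = i" using in_column[OF k] by auto
      have "p \<noteq> 0" "p \<noteq> 1" using fk f(1)[OF kN(1)] by (auto simp: matched_regions_def)
      then have p': "p - 1 < i" "1 \<le> p - 1" "p - 1 < n" "Suc (p - 1) = p" using p less.prems by simp_all
      from less.IH[OF p'(1-3)] obtain j where j: "start (p - 1) \<le> j" "j < start p" "f j = (0, p)"
        unfolding p'(4) by auto
      then have "j < N" "column j = p - 1" using in_column[of "p - 1" j] p' by auto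
      then show False using inj[OF kN(1) \<open>j < N\<close>] fk j(3) kN p' by simp
    qed
    show ?case
    proof (rule ccontr)
      assume none: "\<not> ?thesis"
      have "f ` {start i..<start (Suc i)} \<subseteq> {start i<..<start (Suc i)} \<times> {i}"
      proof (rule image_subsetI)
        fix k assume "k \<in> {start i..<start (Suc i)}"
        then have k: "start i \<le> k" "k < start (Suc i)" by simp_all
        have kN: "k < N" "column k = i" using in_column[OF k] by auto
        have "f k \<noteq> (0, i)" "f k \<noteq> (0, i - 1)" "f k \<noteq> (0, Suc i)"
          using not_used[OF k] none k by auto
        then show "f k \<in> {start i<..<start (Suc i)} \<times> {i}"
          using near[OF kN(1)] unfolding kN(2) by (auto simp: region_def split: if_splits)
      qed
      moreover have "inj_on f {start i..<start (Suc i)}"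
        using inj in_column by (auto intro!: inj_onI)
      ultimately have "card {start i..<start (Suc i)} \<le> card ({start i<..<start (Suc i)} \<times> {i})"
        by (intro card_inj_on_le) auto
      then show False
        using start_less[OF less.prems] by (simp add: card_cartesian_product)
    qed
  qed
  define J where "J = (\<lambda>i\<in>{1..<n}. SOME j. start i \<le> j \<and> j < start (Suc i) \<and> f j = (0, Suc i))"
  have Ji: "start i \<le> J i \<and> J i < start (Suc i) \<and> f (J i) = (0, Suc i)" if "1 \<le> i" "i < n" for i
    using someI_ex[OF pivot[OF that]] that by (simp add: J_def)
  have J: "J \<in> choices"
    unfolding choices_def using Ji by (auto simp: J_def)
  have two: "f k = (Suc k, i) \<and> Suc k < start (Suc i) \<or> f k = (k, i) \<and> start i < k"
    if i: "1 \<le> i" "i < n" and k: "start i \<le> k" "k < start (Suc i)" "k \<noteq> J i" for i k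
  proof -
    have kN: "k < N" "column k = i" using in_column[OF k(1,2)] by auto
    have "f k \<noteq> (0, p)" if p: "p \<in> {i - 1, i, Suc i}" for p
    proof
      assume fk: "f k = (0, p)"
      have "p \<noteq> 0" "p \<noteq> 1" using fk f(1)[OF kN(1)] by (auto simp: matched_regions_def)
      then have p': "1 \<le> p - 1" "p - 1 < n" "Suc (p - 1) = p" using p i by auto
      note Jp = Ji[OF p'(1,2)]
      have JN: "J (p - 1) < N" "column (J (p - 1)) = p - 1" using in_column[of "p - 1"] Jp by auto
      then have "k = J (p - 1)" using inj[OF kN(1) JN(1)] fk Jp p' by simp
      with JN kN k(3) show False by simp
    qed
    then show ?thesis using near[OF kN(1)] unfolding kN(2) by (auto simp: region_def split: if_splits)
  qed
  have below: "f k = (Suc k, i)"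
    if i: "1 \<le> i" "i < n" and k: "start i \<le> k" "k < J i" for i k
    using k
  proof (induction k rule: less_induct)
    case (less k)
    have kJ: "k < start (Suc i)" using less.prems Ji[OF i] by simp
    show ?case
    proof (rule ccontr)
      assume "f k \<noteq> (Suc k, i)"
      then have fk: "f k = (k, i)" "start i < k" using two[OF i less.prems(1) kJ] less.prems by auto
      then have "f (k - 1) = (k, i)" using less.IH[of "k - 1"] less.prems by simp
      moreover have "k - 1 < N" "k < N" using in_column[OF less.prems(1) kJ] by auto
      ultimately have "k - 1 = k" using inj fk by simp
      with fk(2) show False by simp
    qed
  qed
  have above: "f k = (k, i)"
    if i: "1 \<le> i" "i < n" and k: "J i < k" "k < start (Suc i)" for i k
    using k
  proof (induction "start (Suc i) - k" arbitrary: k rule: less_induct)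
    case less
    have kJ: "start i \<le> k" using less.prems Ji[OF i] by simp
    show ?case
    proof (rule ccontr)
      assume "f k \<noteq> (k, i)"
      then have fk: "f k = (Suc k, i)" "Suc k < start (Suc i)" using two[OF i kJ less.prems(2)] less.prems by auto
      then have "f (Suc k) = (Suc k, i)" using less.hyps[of "Suc k"] less.prems by simp
      moreover have "Suc k < N" "k < N" using in_column[of i "Suc k"] fk(2) kJ by auto
      ultimately have "Suc k = k" using inj fk by simp
      then show False by simp
    qed
  qed
  have "f k = matched J k" if k: "k < N" for k
    using column_spec[OF k] below[of "column k" k] above[of "column k" k] Ji[of "column k"]
    by (auto simp: matched_def)
  then have "P = matching J" unfolding P matching_def by (intro image_cong) simp_all
  with J show ?thesis by blast
qed

lemma prod_pivot:
  fixes j a b :: nat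
  assumes "a \<le> j" "j < b"
  shows "(\<Prod>k\<in>{a..<b}. if k < j then u else if k = j then v else w) =
    (u :: 'a :: comm_monoid_mult) ^ (j - a) * v * w ^ (b - 1 - j)"
proof -
  let ?f = "\<lambda>k. if k < j then u else if k = j then v else w"
  have "prod ?f {a..<b} = prod ?f {a..<j} * prod ?f {j..<b}"
    by (rule prod.atLeastLessThan_concat[symmetric]) (use assms in simp_all)
  also have "prod ?f {a..<j} = u ^ (j - a)" by simp
  also have "prod ?f {j..<b} = v * prod ?f {Suc j..<b}"
    using assms by (simp add: prod.atLeast_Suc_lessThan)
  also have "prod ?f {Suc j..<b} = w ^ (b - 1 - j)" by simp
  finally show ?thesis by (simp add: mult.assoc)
qed

definition choice_weight :: "nat \<Rightarrow> nat \<Rightarrow> laurent" where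
  "choice_weight i j = (- A_pow (-3 * twist_sign pos)) ^ (j - start i) *
     (if j = start i then - A_pow (3 * twist_sign pos) else A_pow (- twist_sign pos)) *
     A_pow (twist_sign pos) ^ (start (Suc i) - 1 - j)"

lemma prod_columns:
  assumes "1 \<le> q"
  shows "(\<Prod>k<start q. g k) = (\<Prod>i=1..<q. \<Prod>k\<in>{start i..<start (Suc i)}. g k :: laurent)"
  using assms
proof (induction q rule: nat_induct_at_least)
  case (Suc q)
  have "(\<Prod>k<start (Suc q). g k) = (\<Prod>k<start q. g k) * (\<Prod>k\<in>{start q..<start (Suc q)}. g k)"
    using prod.atLeastLessThan_concat[of 0 "start q" "start (Suc q)" g] start_mono[of q "Suc q"]
    by (simp add: lessThan_atLeast0)
  with Suc show ?case by simp
qed simp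

lemma matching_weight:
  assumes "J \<in> choices"
  shows "(\<Prod>e\<in>matching J. edge_weight diagram shaded crossing_order e) =
    (\<Prod>i=1..<n. choice_weight i (J i))"
proof -
  let ?w = "edge_weight diagram shaded crossing_order"
  have "(\<Prod>e\<in>matching J. ?w e) = (\<Prod>k<N. ?w (k, face (matched J k)))"
    unfolding matching_def by (subst prod.reindex) (auto intro: inj_onI)
  also have "\<dots> = (\<Prod>i=1..<n. \<Prod>k\<in>{start i..<start (Suc i)}. ?w (k, face (matched J k)))"
    using n_ge_2 by (intro prod_columns) simp
  also have "\<dots> = (\<Prod>i=1..<n. choice_weight i (J i))"
  proof (rule prod.cong[OF refl])
    fix i assume "i \<in> {1..<n}"
    then have i: "1 \<le> i" "i < n" by simp_all
    note J = choiceD[OF assms i]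
    let ?v = "if J i = start i then - A_pow (3 * twist_sign pos) else A_pow (- twist_sign pos)"
    have "(\<Prod>k\<in>{start i..<start (Suc i)}. ?w (k, face (matched J k))) =
        (\<Prod>k\<in>{start i..<start (Suc i)}. if k < J i then - A_pow (-3 * twist_sign pos)
           else if k = J i then ?v else A_pow (twist_sign pos))"
    proof (rule prod.cong[OF refl])
      fix k assume "k \<in> {start i..<start (Suc i)}"
      then have k: "k < N" "column k = i" "k < start (Suc i)"
        using column_eqI[of i k] start_le_N[of "Suc i"] by auto
      show "?w (k, face (matched J k)) = (if k < J i then - A_pow (-3 * twist_sign pos)
           else if k = J i then ?v else A_pow (twist_sign pos))"
        using edge_weight_inner_below[OF k(1)] edge_weight_inner_above[OF k(1)]
          edge_weight_outer[OF k(1)] J(1,2) k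
        by (auto simp: matched_def)
    qed
    also have "\<dots> = choice_weight i (J i)"
      unfolding choice_weight_def by (rule prod_pivot) (use J in simp_all)
    finally show "(\<Prod>k\<in>{start i..<start (Suc i)}. ?w (k, face (matched J k))) = choice_weight i (J i)" .
  qed
  finally show ?thesis .
qed

text \<open>The weights are the summands of \<open>twist_coeff\<close>, except that of the first crossing, whose edge to the
big face is active; the correction is exactly the circle term of \<open>column_bracket\<close>.\<close>
lemma sum_choice_weight:
  assumes "1 \<le> i" "i < n"
  shows "(\<Sum>j\<in>{start i..<start (Suc i)}. choice_weight i j) = column_bracket (M i)"
proof -
  let ?e = "twist_sign pos"
  obtain m where m: "M i = Suc m" using M_pos[OF assms] by (cases "M i") auto
  \<comment> \<open>the summands of \<open>twist_coeff\<close>; the correction below turns \<open>A\<^bsup>-e\<^esup>\<close> into \<open>-A\<^bsup>3e\<^esup>\<close> at \<open>t = 0\<close>\<close>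
  let ?c = "\<lambda>t. A_pow (- ?e) * (- A_pow (-3 * ?e)) ^ t * A_pow ?e ^ (m - t)"
  have "(\<Sum>j\<in>{start i..<start (Suc i)}. choice_weight i j) = (\<Sum>t<Suc m. choice_weight i (start i + t))"
    by (rule sum.reindex_bij_witness[of _ "\<lambda>t. start i + t" "\<lambda>j. j - start i"])
      (auto simp: start_Suc m)
  also have "\<dots> = (\<Sum>t<Suc m. ?c t + (if t = 0 then - A_pow (3 * ?e) * A_pow ?e ^ m - A_pow (- ?e) * A_pow ?e ^ m else 0))"
    by (rule sum.cong) (auto simp: choice_weight_def start_Suc m algebra_simps)
  also have "\<dots> = twist_coeff ?e (M i) - A_pow (3 * ?e) * A_pow ?e ^ m - A_pow (- ?e) * A_pow ?e ^ m"
    by (simp add: sum.distrib twist_coeff_def m del: sum.lessThan_Suc)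
  also have "\<dots> = column_bracket (M i)"
    unfolding column_bracket_def loop_value_twist_sign[of pos]
    by (simp add: m A_pow_power A_pow_mult algebra_simps)
  finally show ?thesis .
qed

lemma partition_function_diagram:
  "partition_function diagram shaded (faces diagram - {face (0, 1), face (0, 0)}) crossing_order =
    bracket diagram"
proof -
  have "partition_function diagram shaded (faces diagram - {face (0, 1), face (0, 0)}) crossing_order =
      (\<Sum>P\<in>matching ` choices. \<Prod>e\<in>P. edge_weight diagram shaded crossing_order e)"
  proof -
    have "{P. is_matching P} = matching ` choices"
      using matching_perfect perfect_matching_choice by blast
    then show ?thesis unfolding partition_function_def length_crossings matched_faces by simp
  qed
  also have "\<dots> = (\<Sum>J\<in>choices. \<Prod>i=1..<n. choice_weight i (J i))"
    by (subst sum.reindex[OF inj_on_matching]) (simp add: matching_weight)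
  also have "\<dots> = (\<Prod>i=1..<n. \<Sum>j\<in>{start i..<start (Suc i)}. choice_weight i j)"
    unfolding choices_def by (rule prod_sum_PiE[symmetric]) simp_all
  also have "\<dots> = bracket diagram"
    unfolding bracket_diagram by (rule prod.cong) (simp_all add: sum_choice_weight)
  finally show ?thesis .
qed

lemma touch_along_strand_omitted: "touch_along_strand diagram (face (0, 1)) (face (0, 0))"
proof -
  have "face_of diagram (corner_at 0 0) = face (0, 0)" "face_of diagram (corner_at 0 3) = face (0, 1)"
    using N_pos column_0 by (simp_all add: face_of_corner corner_region_def region_def)
  moreover have "corner_at 0 3 = (0, (snd (corner_at 0 0) + 3) mod 4)"
    using corner_at_plus[of 0 0 3] by simp
  moreover have "corner_at 0 0 = (0, snd (corner_at 0 0))"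
    by (metis fst_corner_at prod.collapse)
  moreover have "corner_at 0 0 \<in> corners diagram"
    using N_pos by (rule corner_at_in_corners) simp
  ultimately show ?thesis
    unfolding touch_along_strand_def
    by (intro bexI[of _ "corner_at 0 0"]) (auto simp: split_beta)
qed

theorem dimer_model: "admits_dimer_model diagram (closure_outer_corner word)"
  unfolding admits_dimer_model_def
proof (intro exI conjI)
  show "checkerboard diagram (closure_outer_corner word) shaded" by (rule checkerboard_shaded)
  show "face (0, 1) \<in> shaded" using face_in_shaded[OF zero_regions(2)] by simp
  show "face (0, 0) \<in> faces diagram - shaded"
    using face_in_shaded[OF zero_regions(1)] zero_regions(1) by (simp add: faces_diagram)
  show "touch_along_strand diagram (face (0, 1)) (face (0, 0))" by (rule touch_along_strand_omitted)
  show "linear_order_on {..<length (crossings diagram)} crossing_order"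
    using linear_order_crossing_order by simp
  show "partition_function diagram shaded (faces diagram - {face (0, 1), face (0, 0)}) crossing_order =
      bracket diagram"
    by (rule partition_function_diagram)
qed

end

text \<open>The common sign of the exponents is read off from \<open>m 1\<close>; outside the range of letters the
exponents are set to \<open>0\<close>, so that columns \<open>0\<close> and \<open>n\<close> are empty.\<close>
theorem theorem7p1:
  fixes n :: nat and m :: "nat \<Rightarrow> int" and w :: braid_word
  assumes "n \<ge> 2"
    and "(\<forall>i\<in>{1..n - 1}. m i > 0) \<or> (\<forall>i\<in>{1..n - 1}. m i < 0)"
    and "w = concat (map (\<lambda>i. generator_power i (m i)) [1..<n])"
  shows "admits_dimer_model (braid_closure n w) (closure_outer_corner w)"
proof -
  define pos where "pos \<longleftrightarrow> m 1 > 0"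
  define M where "M i = (if 1 \<le> i \<and> i < n then nat \<bar>m i\<bar> else 0)" for i
  have sign: "m i > 0 \<longleftrightarrow> pos" "m i \<noteq> 0" if "1 \<le> i" "i < n" for i
    using assms(1,2) that by (force simp: pos_def)+
  interpret twist_braid n M pos
    by unfold_locales (use assms(1) sign in \<open>auto simp: M_def\<close>)
  have "w = word"
    unfolding assms(3) word_def generator_power_def
    by (intro arg_cong[of _ _ concat] map_cong) (auto simp: M_def sign)
  then show ?thesis using dimer_model by simp
qed

end
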